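(* Let $n\geq 1$ be an integer, let $1\leq p<\infty$, and let $f\in L^p(S,\sigma)$. Then $f\in H^p(S)$ if and only if for every pair of multi-indices $\alpha,\beta\in(\mathbb{N}\cup\{0\})^n$ the following hold: (a) If $\alpha_j>\beta_j$ for some $1\leq j\leq n$, then $$\int_{S} \zeta^\alpha\,\overline{\zeta}^{\beta} f(\zeta)\,d\sigma(\zeta)=0.$$ (b) If $\alpha_j\leq \beta_j$ for all $1\leq j\leq n$, then, with $\beta-\alpha=(\beta_1-\alpha_1,\ldots,\beta_n-\alpha_n)$, $$c_{\beta}^{-1}\int_{S}\zeta^\alpha\,\overline{\zeta}^{\beta}f(\zeta)\,d\sigma(\zeta)=c_{\beta-\alpha}^{-1}\int_{S}\overline{\zeta}^{\beta-\alpha}f(\zeta)\,d\sigma(\zeta).$$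
   Context: Fix $n\in\mathbb{N}$, $n\ge 1$. $B=\{z\in\mathbb{C}^n: |z_1|^2+\cdots+|z_n|^2<1\}$ is the open unit ball and $S=\{z\in\mathbb{C}^n: |z_1|^2+\cdots+|z_n|^2=1\}$ is the unit sphere. $\sigma$ is the standard surface measure on $S$, normalized so that $\sigma(S)=1$. For $1\le p<\infty$, $L^p(S,\sigma)$ is the space of (classes of) functions $f:S\to\mathbb{C}$ with $\int_S|f|^p\,d\sigma<\infty$, with norm $\|f\|_p=(\int_S|f|^p\,d\sigma)^{1/p}$. A function $F:B\to\mathbb{C}$ is holomorphic if it is continuous and holomorphic in each of its $n$ complex variables separately. $A(S)$ denotes the set of functions on $S$ that are restrictions to $S$ of functions continuous on the closure $\overline{B}$ and holomorphic on $B$. For $1\le p<\infty$, $H^p(S)$ denotes the closure of $A(S)$ in $L^p(S,\sigma)$. A multi-index is an element $\alpha=(\alpha_1,\ldots,\alpha_n)\in(\mathbb{N}\cup\{0\})^n$. For $z\in\mathbb{C}^n$, $\overline{z}=(\overline{z}_1,\ldots,\overline{z}_n)$ and $z^\alpha=z_1^{\alpha_1}\cdots z_n^{\alpha_n}$; so $\overline{\zeta}^{\beta}=\overline{\zeta}_1^{\beta_1}\cdots\overline{\zeta}_n^{\beta_n}$. Also $|\alpha|=\alpha_1+\cdots+\alpha_n$ and $\alpha!=\alpha_1!\cdots\alpha_n!$. For a multi-index $\omega$, $$c_\omega:=\frac{(n-1)!\,\omega!}{(n-1+|\omega|)!}.$$ *)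

theory Defs
  imports "HOL-Complex_Analysis.Complex_Analysis"
begin

text \<open>
  Points of complex n-space are vectors of type \<open>complex ^ 'n\<close>, where n = \<open>CARD('n) \<ge> 1\<close>; the
  norm of this type is the Euclidean one, so the open unit ball, the closed unit ball and the unit
  sphere are \<open>ball 0 1\<close>, \<open>cball 0 1\<close> and \<open>sphere 0 1\<close>. Functions on the sphere are represented by
  total functions on \<open>complex ^ 'n\<close>; no notion below depends on their values off the sphere.
\<close>

subsection \<open>Normalized surface measure\<close>

text \<open>
  Polar-coordinate definition: the measure of a Borel subset A of the sphere is the Lebesgue volume
  of the cone \<open>{z \<in> ball 0 1. z / |z| \<in> A}\<close> divided by the volume of the ball (note that
  \<open>sgn z = z / |z|\<close>). The lemmas following the definition confirm that this is the
  rotation invariant Borel probability measure on the sphere.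
\<close>

definition sphere_measure :: "(complex ^ 'n) measure" where
  "sphere_measure =
     restrict_space (distr (uniform_measure lborel (ball 0 1)) borel sgn) (sphere 0 1)"

lemma borel_measurable_sgn_vec [measurable]:
  "(sgn :: 'a :: euclidean_space \<Rightarrow> 'a) \<in> borel_measurable borel"
  unfolding sgn_div_norm[abs_def] by measurable

lemma space_sphere_measure [simp]: "space (sphere_measure :: (complex ^ 'n) measure) = sphere 0 1"
  by (simp add: sphere_measure_def space_restrict_space)

lemma sets_sphere_measure [measurable_cong]:
  "sets (sphere_measure :: (complex ^ 'n) measure) = sets (restrict_space borel (sphere 0 1))"
  by (simp add: sphere_measure_def sets_restrict_space)

lemma emeasure_sphere_measure:
  fixes A :: "(complex ^ 'n) set"
  assumes "A \<in> sets borel" "A \<subseteq> sphere 0 1"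
  shows "emeasure sphere_measure A =
           emeasure lborel {z \<in> ball 0 1. sgn z \<in> A} / emeasure lborel (ball (0 :: complex ^ 'n) 1)"
proof -
  have "emeasure sphere_measure A = emeasure (uniform_measure lborel (ball 0 1)) (sgn -` A)"
    using assms by (simp add: sphere_measure_def emeasure_restrict_space emeasure_distr)
  also have "\<dots> = emeasure lborel (ball 0 1 \<inter> sgn -` A) / emeasure lborel (ball (0 :: complex ^ 'n) 1)"
    using assms measurable_sets[OF borel_measurable_sgn_vec assms(1)]
    by (intro emeasure_uniform_measure) auto
  also have "ball 0 1 \<inter> sgn -` A = {z \<in> ball 0 1. sgn z \<in> A}"
    by auto
  finally show ?thesis .
qed

lemma emeasure_lborel_unit_ball:
  "emeasure lborel (ball (0 :: 'a :: euclidean_space) 1) \<noteq> 0"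
  "emeasure lborel (ball (0 :: 'a :: euclidean_space) 1) < \<infinity>"
  by (simp_all add: emeasure_ball unit_ball_vol_pos[THEN less_imp_neq, symmetric])

lemma emeasure_sphere_measure_space:
  "emeasure sphere_measure (sphere (0 :: complex ^ 'n) 1) = 1"
proof -
  let ?B = "ball (0 :: complex ^ 'n) 1"
  have "{z \<in> ?B. sgn z \<in> sphere 0 1} = ?B - {0}"
    by (auto simp: norm_sgn)
  moreover have "emeasure lborel (?B - {0}) = emeasure lborel ?B"
    by (intro emeasure_Diff_null_set) (auto simp: null_sets_def)
  ultimately show ?thesis
    using emeasure_lborel_unit_ball[where 'a = "complex ^ 'n"]
    by (simp add: emeasure_sphere_measure)
qed

lemma emeasure_lborel_translation:
  fixes X :: "'a :: euclidean_space set"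
  assumes "X \<in> sets borel"
  shows "emeasure lborel ((\<lambda>y. c + y) -` X) = emeasure lborel X"
proof -
  have "emeasure lborel X = emeasure (distr lborel borel ((+) c)) X"
    by (simp add: lborel_distr_plus)
  also have "\<dots> = emeasure lborel ((\<lambda>y. c + y) -` X)"
    using assms by (subst emeasure_distr) auto
  finally show ?thesis by simp
qed

lemma orthogonal_transformation_borel_measurable:
  fixes U :: "'a :: euclidean_space \<Rightarrow> 'a"
  assumes "orthogonal_transformation U"
  shows "U \<in> borel_measurable borel"
  using orthogonal_transformation_linear[OF assms]
  by (intro borel_measurable_continuous_onI linear_continuous_on)
     (simp add: linear_conv_bounded_linear)

lemma emeasure_lborel_orthogonal_vimage:
  fixes U :: "'a :: euclidean_space \<Rightarrow> 'a"
  assumes U: "orthogonal_transformation U" and B [measurable]: "B \<in> sets borel"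
  shows "emeasure lborel (U -` B) = emeasure lborel B"
proof -
  define V where "V = inv U"
  define A where "A = ball (0 :: 'a) 1"
  have [measurable]: "U \<in> borel_measurable borel" "A \<in> sets borel"
    using orthogonal_transformation_borel_measurable[OF U] by (simp_all add: A_def)
  have lin: "linear U" and nrm: "\<And>z. norm (U z) = norm z"
    using U by (auto simp: orthogonal_transformation)
  have UV: "U (V z) = z" for z
    unfolding V_def by (rule surj_f_inv_f[OF orthogonal_transformation_surj[OF U]])
  have UB [measurable]: "U -` B \<in> sets borel"
    using measurable_sets[of U borel borel B] by simp
  have meas: "{x. c + f x \<in> X} \<in> sets borel"
    if [measurable]: "f \<in> borel_measurable borel" "X \<in> sets borel" for c and f :: "'a \<Rightarrow> 'a" and X
    by measurable
  have 1: "(\<integral>\<^sup>+y. indicator B (x + U y) \<partial>lborel) = emeasure lborel (U -` B)" for x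
  proof -
    have "(\<integral>\<^sup>+y. indicator B (x + U y) \<partial>lborel) =
            (\<integral>\<^sup>+y. indicator ((\<lambda>y. V x + y) -` (U -` B)) y \<partial>lborel)"
      by (intro nn_integral_cong) (auto simp: indicator_def linear_add[OF lin] UV)
    also have "\<dots> = emeasure lborel ((\<lambda>y. V x + y) -` (U -` B))"
      using measurable_sets[of "\<lambda>y. V x + y" borel borel "U -` B"]
      by (intro nn_integral_indicator) simp
    finally show ?thesis
      by (simp add: emeasure_lborel_translation)
  qed
  have 2: "(\<integral>\<^sup>+y. indicator A (- U y + x) \<partial>lborel) = emeasure lborel A" for x
  proof -
    have *: "norm (x - U y) = norm (- V x + y)" for y
      using nrm[of "- V x + y"]
      by (simp only: linear_add[OF lin] linear_neg[OF lin] UV) (simp add: norm_minus_commute)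
    have "(\<integral>\<^sup>+y. indicator A (- U y + x) \<partial>lborel) =
            (\<integral>\<^sup>+y. indicator ((\<lambda>y. - V x + y) -` A) y \<partial>lborel)"
      by (intro nn_integral_cong) (use * in \<open>simp add: indicator_def A_def\<close>)
    also have "\<dots> = emeasure lborel ((\<lambda>y. - V x + y) -` A)"
      using measurable_sets[of "\<lambda>y. - V x + y" borel borel A]
      by (intro nn_integral_indicator) simp
    finally show ?thesis
      by (simp only: emeasure_lborel_translation[OF \<open>A \<in> sets borel\<close>])
  qed
  have 3: "(\<integral>\<^sup>+x. indicator A x * indicator B (x + U y) \<partial>lborel) =
          (\<integral>\<^sup>+x. indicator A (- U y + x) * indicator B x \<partial>lborel)" for y
  proof -
    have "(\<integral>\<^sup>+x. indicator A (- U y + x) * indicator B x \<partial>lborel) =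
          (\<integral>\<^sup>+x. indicator A (- U y + x) * indicator B x \<partial>distr lborel borel ((+) (U y)))"
      by (simp only: lborel_distr_plus)
    also have "\<dots> = (\<integral>\<^sup>+x. indicator A x * indicator B (x + U y) \<partial>lborel)"
      by (subst nn_integral_distr) (simp_all add: add_ac)
    finally show ?thesis by simp
  qed
  have "emeasure lborel A * emeasure lborel (U -` B) =
          (\<integral>\<^sup>+x. indicator A x * (\<integral>\<^sup>+y. indicator B (x + U y) \<partial>lborel) \<partial>lborel)"
    by (simp add: 1 nn_integral_multc)
  also have "\<dots> = (\<integral>\<^sup>+x. \<integral>\<^sup>+y. indicator A x * indicator B (x + U y) \<partial>lborel \<partial>lborel)"
    by (intro nn_integral_cong nn_integral_cmult[symmetric]) simp
  also have "\<dots> = (\<integral>\<^sup>+y. \<integral>\<^sup>+x. indicator A x * indicator B (x + U y) \<partial>lborel \<partial>lborel)"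
    by (intro lborel_pair.Fubini') simp
  also have "\<dots> = (\<integral>\<^sup>+y. \<integral>\<^sup>+x. indicator A (- U y + x) * indicator B x \<partial>lborel \<partial>lborel)"
    by (simp only: 3)
  also have "\<dots> = (\<integral>\<^sup>+x. \<integral>\<^sup>+y. indicator A (- U y + x) * indicator B x \<partial>lborel \<partial>lborel)"
    by (intro lborel_pair.Fubini') simp
  also have "\<dots> = (\<integral>\<^sup>+x. emeasure lborel A * indicator B x \<partial>lborel)"
    by (intro nn_integral_cong) (simp add: nn_integral_multc 2[simplified])
  also have "\<dots> = emeasure lborel A * emeasure lborel B"
    by (simp add: nn_integral_cmult)
  finally show ?thesis
    using emeasure_lborel_unit_ball[where 'a = 'a] by (auto simp: A_def ennreal_mult_cancel_left)
qed

lemma sphere_measure_rotation_invariant: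
  fixes U :: "complex ^ 'n \<Rightarrow> complex ^ 'n"
  assumes U: "orthogonal_transformation U" and A: "A \<in> sets borel" "A \<subseteq> sphere 0 1"
  shows "emeasure sphere_measure (U -` A) = emeasure sphere_measure A"
proof -
  define C where "C = {z \<in> ball 0 1. sgn z \<in> A}"
  have lin: "linear U" and nrm: "\<And>z. norm (U z) = norm z"
    using U by (auto simp: orthogonal_transformation)
  have sgn_U: "sgn (U z) = U (sgn z)" for z
    by (simp add: sgn_div_norm nrm linear_scale[OF lin])
  have UA: "U -` A \<in> sets borel" "U -` A \<subseteq> sphere 0 1"
    using measurable_sets[OF orthogonal_transformation_borel_measurable[OF U] A(1)] A(2) nrm
    by force+
  have "C = ball 0 1 \<inter> (sgn -` A \<inter> space borel)"
    by (auto simp: C_def)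
  also have "\<dots> \<in> sets borel"
    by (intro sets.Int measurable_sets[OF borel_measurable_sgn_vec A(1)]) auto
  finally have "C \<in> sets borel" .
  moreover have "U -` C = {z \<in> ball 0 1. sgn z \<in> U -` A}"
    by (auto simp: C_def nrm sgn_U)
  ultimately show ?thesis
    using A UA emeasure_lborel_orthogonal_vimage[OF U, of C]
    by (simp add: emeasure_sphere_measure C_def)
qed

subsection \<open>Lebesgue spaces\<close>

definition Lp_space :: "'a measure \<Rightarrow> real \<Rightarrow> ('a \<Rightarrow> complex) set" where
  "Lp_space M p = {f \<in> borel_measurable M. integrable M (\<lambda>x. norm (f x) powr p)}"

definition Lp_norm :: "'a measure \<Rightarrow> real \<Rightarrow> ('a \<Rightarrow> complex) \<Rightarrow> real" where
  "Lp_norm M p f = (\<integral>x. norm (f x) powr p \<partial>M) powr (1 / p)"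

subsection \<open>Hardy spaces on the sphere\<close>

definition sep_holomorphic_on_ball :: "(complex ^ 'n \<Rightarrow> complex) \<Rightarrow> bool" where
  "sep_holomorphic_on_ball F \<longleftrightarrow>
     continuous_on (ball 0 1) F \<and>
     (\<forall>z \<in> ball 0 1. \<forall>j.
        (\<lambda>w. F (\<chi> i. if i = j then w else z $ i))
          holomorphic_on {w. (\<chi> i. if i = j then w else z $ i) \<in> ball 0 1})"

definition sphere_algebra :: "(complex ^ 'n \<Rightarrow> complex) set" where
  "sphere_algebra =
     {g. \<exists>G. continuous_on (cball 0 1) G \<and> sep_holomorphic_on_ball G \<and>
             (\<forall>\<zeta> \<in> sphere 0 1. g \<zeta> = G \<zeta>)}"

text \<open>
  The elements of \<open>Lp_space\<close> are functions rather than classes, so the closure is taken with respect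
  to the seminorm \<open>Lp_norm\<close>; the resulting set is closed under almost everywhere equality.
\<close>

definition Hardy_space :: "real \<Rightarrow> (complex ^ 'n \<Rightarrow> complex) set" where
  "Hardy_space p =
     {f \<in> Lp_space sphere_measure p.
        \<forall>\<epsilon> > 0. \<exists>g \<in> sphere_algebra. Lp_norm sphere_measure p (\<lambda>\<zeta>. f \<zeta> - g \<zeta>) < \<epsilon>}"

subsection \<open>Multi-indices\<close>

definition vec_power :: "complex ^ 'n \<Rightarrow> ('n \<Rightarrow> nat) \<Rightarrow> complex" where
  "vec_power z \<alpha> = (\<Prod>j\<in>UNIV. (z $ j) ^ \<alpha> j)"

definition vec_cnj :: "complex ^ 'n \<Rightarrow> complex ^ 'n" where
  "vec_cnj z = (\<chi> j. cnj (z $ j))"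

definition multi_coeff :: "('n :: finite \<Rightarrow> nat) \<Rightarrow> real" where
  "multi_coeff \<omega> =
     fact (CARD('n) - 1) * (\<Prod>j\<in>UNIV. fact (\<omega> j)) / fact (CARD('n) - 1 + (\<Sum>j\<in>UNIV. \<omega> j))"

end

theory Submission
  imports Defs "HOL-Probability.Probability"
begin

text \<open>
  Necessity: averaging \<open>g \<in> A(S)\<close> over rotations of one coordinate after the other projects it to its
  component of multi-degree \<open>\<gamma>\<close>, which by Cauchy's formula is homogeneous in each coordinate and hence
  equals \<open>C z\<^sup>\<gamma>\<close>, without changing the integrals against \<open>\<zeta>\<^sup>\<alpha> cnj \<zeta>\<^sup>\<alpha>\<^sup>+\<^sup>\<gamma>\<close>. These integrals are
  therefore \<open>C c\<^sub>\<alpha>\<^sub>+\<^sub>\<gamma>\<close>, and the conditions pass to the \<open>L\<^sup>p\<close> closure.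

  Sufficiency: the kernels proportional to \<open>(1 + Re \<langle>x, y\<rangle>)\<^sup>m\<close> form a rotation invariant approximate
  identity on the sphere, so the corresponding means of \<open>f\<close> converge to \<open>f\<close> in \<open>L\<^sup>p\<close>. The kernel is a
  polynomial in \<open>\<langle>x, y\<rangle>\<close> and \<open>\<langle>y, x\<rangle>\<close>; expanding it with the multinomial theorem and inserting the
  moment conditions shows that each mean is a holomorphic polynomial in \<open>x\<close> on the sphere.
\<close>

subsection \<open>Integration on the sphere\<close>

text \<open>\<open>c\<^sub>\<beta>\<close> is the squared \<open>L\<^sup>2\<close> norm of the
  monomial of index \<beta>. Condition (b) thus says that a moment divided by this norm depends on
  \<beta> - \<alpha> only, the common value being the Taylor coefficient of that index.

  Holomorphy is given in each variable separately, so the argument stays with Cauchy's formula in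
  one variable. After one average the function is no longer known to be separately holomorphic; what
  survives the iteration is homogeneity under the whole closed disc. Homogeneity under the circle
  alone would still admit factors such as |z_j|^2.

  Conversely, the means must converge in every \<open>L\<^sup>p\<close>, including p = 1, where the
  Cauchy projection is unbounded. A nonnegative kernel with integral 1 in each variable contracts
  every \<open>L\<^sup>p\<close> by Jensen's inequality. On the sphere 1 + Re <x, y> is nonnegative
  and equals 2 - |x - y|^2 / 2, so it peaks exactly at y = x, and its powers lead to finite sums
  only. Their expansion also contains conjugates of x; the moment conditions collect these into
  powers of <x, x>, which is 1 on the sphere.\<close>

lemma measurable_sphere_measure_borel [measurable (raw)]:
  "f \<in> measurable borel N \<Longrightarrow> f \<in> measurable (sphere_measure :: (complex ^ 'n) measure) N"
  by (simp add: sphere_measure_def measurable_restrict_space1)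

interpretation sphere_measure: prob_space "sphere_measure :: (complex ^ 'n) measure"
  by standard (simp add: emeasure_sphere_measure_space)

lemma borel_measurable_sphere_measure_continuous_on:
  "continuous_on (sphere 0 1) f \<Longrightarrow> f \<in> borel_measurable (sphere_measure :: (complex ^ 'n) measure)"
  using borel_measurable_continuous_on_restrict[of "sphere 0 1" f]
  by (simp cong: measurable_cong_sets add: measurable_cong_sets[OF sets_sphere_measure refl])

lemma integrable_sphere_measure_bounded:
  fixes f :: "complex ^ 'n \<Rightarrow> 'b :: {banach, second_countable_topology}"
  assumes "f \<in> borel_measurable sphere_measure" "\<And>z. norm z = 1 \<Longrightarrow> norm (f z) \<le> B"
  shows "integrable sphere_measure f"
  using assms by (intro sphere_measure.integrable_const_bound[where B = B]) (auto intro: AE_I2)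

lemma integrable_sphere_measure_continuous_on:
  fixes f :: "complex ^ 'n \<Rightarrow> 'b :: {banach, second_countable_topology}"
  assumes "continuous_on (sphere 0 1) f"
  shows "integrable sphere_measure f"
proof -
  have "bounded (f ` sphere 0 1)"
    using assms by (intro compact_imp_bounded compact_continuous_image) auto
  then obtain B where "\<And>z. norm z = 1 \<Longrightarrow> norm (f z) \<le> B"
    unfolding bounded_iff by (metis image_eqI mem_sphere_0)
  then show ?thesis
    using assms borel_measurable_sphere_measure_continuous_on
    by (intro integrable_sphere_measure_bounded) auto
qed

lemma measurable_sphere_measure_orthogonal:
  fixes U :: "complex ^ 'n \<Rightarrow> complex ^ 'n"
  assumes "orthogonal_transformation U"
  shows "U \<in> measurable sphere_measure sphere_measure"
proof -
  have "U \<in> measurable (restrict_space borel (sphere 0 1)) (restrict_space borel (sphere 0 1))"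
    using orthogonal_transformation_borel_measurable[OF assms] assms
    by (intro measurable_restrict_space3) (auto simp: orthogonal_transformation)
  then show ?thesis
    by (simp cong: measurable_cong_sets add: measurable_cong_sets[OF sets_sphere_measure sets_sphere_measure])
qed

lemma distr_sphere_measure_orthogonal:
  fixes U :: "complex ^ 'n \<Rightarrow> complex ^ 'n"
  assumes U: "orthogonal_transformation U"
  shows "distr sphere_measure sphere_measure U = sphere_measure"
proof (rule measure_eqI)
  fix A :: "(complex ^ 'n) set"
  assume A: "A \<in> sets (distr sphere_measure sphere_measure U)"
  then have A': "A \<in> sets borel" "A \<subseteq> sphere 0 1"
    by (auto simp: sets_sphere_measure sets_restrict_space_iff)
  have "U -` A \<inter> sphere 0 1 = U -` A"
    using A'(2) U by (force simp: orthogonal_transformation)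
  then show "emeasure (distr sphere_measure sphere_measure U) A = emeasure sphere_measure A"
    using A sphere_measure_rotation_invariant[OF U A']
    by (simp add: emeasure_distr[OF measurable_sphere_measure_orthogonal[OF U]])
qed simp

lemma integral_sphere_measure_orthogonal:
  fixes f :: "complex ^ 'n \<Rightarrow> 'b :: {banach, second_countable_topology}" and U :: "complex ^ 'n \<Rightarrow> complex ^ 'n"
  assumes U: "orthogonal_transformation U" and f: "f \<in> borel_measurable sphere_measure"
  shows "(\<integral>z. f (U z) \<partial>sphere_measure) = (\<integral>z. f z \<partial>sphere_measure)"
  using integral_distr[OF measurable_sphere_measure_orthogonal[OF U] f]
  by (simp add: distr_sphere_measure_orthogonal[OF U])

subsection \<open>Monomials and their moments\<close>

text \<open>One coordinate of the torus action, extended to arbitrary factors: a unimodular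
  \<open>w\<close> gives a unitary map, used for averaging, and a \<open>w\<close> in the closed
  disc gives a contraction, used for Cauchy's formula.\<close>

definition coord_mult :: "'n :: finite \<Rightarrow> complex \<Rightarrow> complex ^ 'n \<Rightarrow> complex ^ 'n" where
  "coord_mult j w z = (\<chi> i. if i = j then w * z $ i else z $ i)"

lemma coord_mult_nth [simp]: "coord_mult j w z $ i = (if i = j then w * z $ i else z $ i)"
  by (simp add: coord_mult_def)

lemma coord_mult_mult: "coord_mult j v (coord_mult j w z) = coord_mult j (v * w) z"
  by (simp add: vec_eq_iff)

lemma coord_mult_commute: "coord_mult i v (coord_mult j w z) = coord_mult j w (coord_mult i v z)"
  by (simp add: vec_eq_iff)

lemma norm_vec_complex_sq: "(norm (z :: complex ^ 'n))\<^sup>2 = (\<Sum>i\<in>UNIV. (norm (z $ i))\<^sup>2)"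
  by (simp add: norm_vec_def L2_set_def sum_nonneg)

lemma norm_coord_mult_le: 
  assumes "norm w \<le> 1" shows "norm (coord_mult j w z) \<le> norm z"
proof -
  have "norm w * norm (z $ j) \<le> norm (z $ j)"
    using assms by (simp add: mult_left_le_one_le)
  then show ?thesis
    unfolding norm_vec_def by (intro L2_set_mono) (auto simp: norm_mult)
qed

lemma norm_coord_mult_eq: "norm w = 1 \<Longrightarrow> norm (coord_mult j w z) = norm z"
  unfolding norm_vec_def by (intro L2_set_cong) (auto simp: norm_mult)

lemma linear_coord_mult: "linear (coord_mult j w)"
  by (rule linearI) (auto simp: vec_eq_iff algebra_simps)

lemma orthogonal_transformation_coord_mult:
  "norm w = 1 \<Longrightarrow> orthogonal_transformation (coord_mult j w)"
  by (simp add: orthogonal_transformation linear_coord_mult norm_coord_mult_eq)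

section \<open>Monomials and their behaviour under \<open>coord_mult\<close>\<close>

lemma continuous_on_vec_power [continuous_intros]:
  "continuous_on A f \<Longrightarrow> continuous_on A (\<lambda>z. vec_power (f z) \<alpha>)"
  unfolding vec_power_def by (intro continuous_intros)

lemma vec_power_vec_cnj: "vec_power (vec_cnj z) \<alpha> = cnj (vec_power z \<alpha>)"
  by (simp add: vec_power_def vec_cnj_def)

lemma vec_power_measurable [measurable]: "(\<lambda>z :: complex ^ 'n. vec_power z \<alpha>) \<in> borel_measurable borel"
  by (intro borel_measurable_continuous_onI continuous_intros)

lemma norm_vec_power_le: 
  assumes "norm z \<le> 1" shows "norm (vec_power z \<alpha>) \<le> 1"
proof -
  have "norm (z $ i) \<le> 1" for i
    using assms Finite_Cartesian_Product.norm_nth_le[of z i] by linarith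
  then show ?thesis
    unfolding vec_power_def by (auto simp: prod_norm[symmetric] norm_power intro!: prod_le_1 power_le_one)
qed

lemma vec_power_coord_mult: "vec_power (coord_mult j w z) \<alpha> = w ^ \<alpha> j * vec_power z \<alpha>"
proof -
  have "vec_power (coord_mult j w z) \<alpha> = (\<Prod>i\<in>UNIV. (if i = j then w ^ \<alpha> i else 1) * (z $ i) ^ \<alpha> i)"
    unfolding vec_power_def by (intro prod.cong) (auto simp: power_mult_distrib)
  then show ?thesis
    by (simp add: prod.distrib vec_power_def)
qed

lemma vec_power_add: "vec_power z (\<lambda>i. \<alpha> i + \<beta> i) = vec_power z \<alpha> * vec_power z \<beta>"
  by (simp add: vec_power_def power_add prod.distrib)

lemma vec_power_fun_upd: "vec_power z (\<alpha>(i := a)) = (z $ i) ^ a * vec_power z (\<alpha>(i := 0))"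
  unfolding vec_power_def
  by (subst (1 2) prod.remove[of UNIV i]) (auto intro!: prod.cong)

lemma vec_power_Suc: "vec_power z (\<alpha>(i := Suc (\<alpha> i))) = z $ i * vec_power z \<alpha>"
  using vec_power_fun_upd[of z \<alpha> i "Suc (\<alpha> i)"] vec_power_fun_upd[of z \<alpha> i "\<alpha> i"] by simp

lemma integrable_sphere_measure_monomial:
  "integrable sphere_measure (\<lambda>z :: complex ^ 'n. vec_power z \<alpha> * cnj (vec_power z \<beta>))"
  by (intro integrable_sphere_measure_continuous_on continuous_intros)

text \<open>Rotating a coordinate in which the exponents differ multiplies the integrand by a
  constant, which a suitable angle turns into -1; the integral then equals its own negative.\<close>

lemma sphere_moment_orthogonal:
  fixes \<alpha> \<beta> :: "'n :: finite \<Rightarrow> nat"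
  assumes "\<alpha> \<noteq> \<beta>"
  shows "(\<integral>z. vec_power z \<alpha> * cnj (vec_power z \<beta>) \<partial>sphere_measure) = 0" (is "?I = 0")
proof -
  obtain j where j: "\<alpha> j \<noteq> \<beta> j"
    using assms by auto
  \<comment> \<open>The angle for which \<open>(\<alpha> j - \<beta> j) * x\<close> is pi; the
    difference is formed in the reals, so either sign is allowed.\<close>
  define x where "x = pi / (real (\<alpha> j) - real (\<beta> j))"
  have "cis x ^ \<alpha> j * cnj (cis x ^ \<beta> j) = cis (real (\<alpha> j) * x + - (real (\<beta> j) * x))"
    by (simp only: complex_cnj_power Complex.DeMoivre cis_cnj cis_mult mult_minus_right)
  also have "real (\<alpha> j) * x + - (real (\<beta> j) * x) = pi"
    using j by (simp add: x_def flip: diff_divide_distrib left_diff_distrib)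
  finally have w: "cis x ^ \<alpha> j * cnj (cis x ^ \<beta> j) = -1"
    by simp
  have "?I = (\<integral>z. vec_power (coord_mult j (cis x) z) \<alpha> * cnj (vec_power (coord_mult j (cis x) z) \<beta>) \<partial>sphere_measure)"
    by (rule integral_sphere_measure_orthogonal[symmetric])
       (auto intro!: orthogonal_transformation_coord_mult borel_measurable_integrable integrable_sphere_measure_monomial)
  also have "\<dots> = (\<integral>z. (cis x ^ \<alpha> j * cnj (cis x ^ \<beta> j)) * (vec_power z \<alpha> * cnj (vec_power z \<beta>)) \<partial>sphere_measure)"
    by (simp add: vec_power_coord_mult mult_ac)
  also have "\<dots> = - ?I"
    unfolding w by simp
  finally show ?thesis by simp
qed

text \<open>A real rotation applied to a pair of complex coordinates. Unlike the diagonal rotations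
  it mixes monomials of equal degree in the two coordinates and thereby relates their
  moments.\<close>

lemma orthogonal_transformation_plane:
  fixes i j :: "'n :: finite"
  assumes "i \<noteq> j" "c\<^sup>2 + s\<^sup>2 = (1 :: real)"
  shows "orthogonal_transformation (\<lambda>z :: complex ^ 'n. \<chi> l. if l = i then of_real c * z $ i + of_real s * z $ j
           else if l = j then of_real c * z $ j - of_real s * z $ i else z $ l)" (is "orthogonal_transformation ?U")
proof -
  have "linear ?U"
    by (rule linearI) (auto simp: vec_eq_iff algebra_simps scaleR_conv_of_real[where 'a = complex])
  moreover have "norm (?U z) = norm z" for z
  proof -
    have *: "(norm (v :: complex ^ 'n))\<^sup>2 = (norm (v $ i))\<^sup>2 + ((norm (v $ j))\<^sup>2 + (\<Sum>l\<in>UNIV - {i} - {j}. (norm (v $ l))\<^sup>2))" for v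
      unfolding norm_vec_complex_sq using assms(1)
      by (simp add: sum.remove[of UNIV i] sum.remove[of "UNIV - {i}" j])
    have "(norm (of_real c * a + of_real s * b))\<^sup>2 + (norm (of_real c * b - of_real s * a))\<^sup>2 =
      (c\<^sup>2 + s\<^sup>2) * ((norm a)\<^sup>2 + (norm b)\<^sup>2)" for a b :: complex
      unfolding cmod_power2 by (simp add: power2_eq_square algebra_simps)
    then have "(norm (?U z))\<^sup>2 = (norm z)\<^sup>2"
      using assms by (simp add: *)
    then show ?thesis by simp
  qed
  ultimately show ?thesis
    by (simp add: orthogonal_transformation)
qed

definition sphere_moment :: "('n :: finite \<Rightarrow> nat) \<Rightarrow> complex" where
  "sphere_moment \<alpha> = (\<integral>z. vec_power z \<alpha> * cnj (vec_power z \<alpha>) \<partial>sphere_measure)"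

text \<open>Rotating a power of one coordinate in the plane of two coordinates gives a polynomial identity
  in the slope \<open>x\<close> of the rotation; its coefficients are the moments sought.\<close>

lemma sphere_moment_two_coordinates:
  fixes \<beta> :: "'n :: finite \<Rightarrow> nat"
  assumes ij: "i \<noteq> j" and "a \<le> k"
  shows "of_nat (k choose a) * sphere_moment (\<beta>(i := a, j := k - a)) = sphere_moment (\<beta>(i := k, j := 0))"
proof -
  define \<omega> where "\<omega> a = \<beta>(i := a, j := k - a)" for a
  have inj: "\<omega> a \<noteq> \<omega> b" if "a \<noteq> b" for a b
    using that ij by (auto simp: \<omega>_def fun_eq_iff)
  \<comment> \<open>Invariance of the moment of \<open>\<omega> k\<close> under a rotation with
    cosine \<open>1 / s\<close> and sine \<open>x / s\<close>, multiplied by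
    \<open>(1 + y) ^ k\<close> to clear denominators. On the left the product of two binomial sums
    keeps only its diagonal by orthogonality, so only even powers of \<open>x\<close>, that is
    powers of \<open>y\<close>, remain.\<close>
  have key: "(\<Sum>a\<le>k. of_nat (k choose a) * (of_nat (k choose a) * sphere_moment (\<omega> a)) * of_real y ^ (k - a)) =
    (\<Sum>a\<le>k. of_nat (k choose a) * sphere_moment (\<omega> k) * of_real y ^ (k - a))" if "y \<ge> 0" for y :: real
  proof -
    define x where "x = sqrt y"
    define s where "s = sqrt (1 + y)"
    have xy: "x\<^sup>2 = y" "s\<^sup>2 = 1 + y" "s > 0"
      using that by (auto simp: x_def s_def)
    define U where "U z = (\<chi> l. if l = i then of_real (1 / s) * z $ i + of_real (x / s) * z $ j
           else if l = j then of_real (1 / s) * z $ j - of_real (x / s) * z $ i else z $ l)" for z :: "complex ^ 'n"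
    have U: "orthogonal_transformation U"
      unfolding U_def using ij xy
      by (intro orthogonal_transformation_plane) (auto simp: power_divide simp flip: add_divide_distrib)
    have exp1: "of_real s ^ k * vec_power (U z) (\<omega> k) =
        (\<Sum>a\<le>k. of_nat (k choose a) * of_real x ^ (k - a) * vec_power z (\<omega> a))" (is "?L = ?R") for z
    proof -
      define V where "V = vec_power z (\<beta>(i := 0, j := 0))"
      have V: "vec_power z (\<beta>(i := a, j := b)) = z $ i ^ a * z $ j ^ b * V" for a b
        using ij unfolding V_def
        by (subst vec_power_fun_upd, subst fun_upd_twist, simp, subst vec_power_fun_upd) (simp add: fun_upd_twist mult_ac)
      have "vec_power (U z) (\<omega> k) = U z $ i ^ k * vec_power (U z) (\<beta>(i := 0, j := 0))"
        using ij by (simp add: \<omega>_def fun_upd_twist[of i j]) (subst vec_power_fun_upd, simp add: fun_upd_twist)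
      also have "vec_power (U z) (\<beta>(i := 0, j := 0)) = V"
        unfolding V_def vec_power_def U_def by (intro prod.cong) auto
      finally have "?L = (of_real s * U z $ i) ^ k * V"
        by (simp add: power_mult_distrib)
      also have "of_real s * U z $ i = z $ i + of_real x * z $ j"
        using xy by (simp add: U_def field_simps)
      also have "(z $ i + of_real x * z $ j) ^ k * V = ?R"
        unfolding binomial_ring sum_distrib_right
        by (intro sum.cong) (simp_all add: \<omega>_def V power_mult_distrib mult_ac)
      finally show ?thesis .
    qed
    have "of_real (1 + y) ^ k * (vec_power (U z) (\<omega> k) * cnj (vec_power (U z) (\<omega> k))) =
        (of_real s ^ k * vec_power (U z) (\<omega> k)) * cnj (of_real s ^ k * vec_power (U z) (\<omega> k))" for z
      unfolding xy(2)[symmetric] by (simp add: power2_eq_square power_mult_distrib mult_ac)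
    also have "\<dots> z = (\<Sum>a\<le>k. \<Sum>b\<le>k. (of_nat (k choose a) * of_real x ^ (k - a) * (of_nat (k choose b) * of_real x ^ (k - b))) * (vec_power z (\<omega> a) * cnj (vec_power z (\<omega> b))))" for z
      unfolding exp1 by (simp add: sum_product mult_ac)
    finally have exp2: "of_real (1 + y) ^ k * (vec_power (U z) (\<omega> k) * cnj (vec_power (U z) (\<omega> k))) = \<dots> z" for z .
    have "of_real (1 + y) ^ k * sphere_moment (\<omega> k) = 
       of_real (1 + y) ^ k * (\<integral>z. vec_power (U z) (\<omega> k) * cnj (vec_power (U z) (\<omega> k)) \<partial>sphere_measure)"
      unfolding sphere_moment_def using integrable_sphere_measure_monomial
      by (subst integral_sphere_measure_orthogonal[OF U]) (auto intro: borel_measurable_integrable)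
    also have "\<dots> = (\<integral>z. of_real (1 + y) ^ k * (vec_power (U z) (\<omega> k) * cnj (vec_power (U z) (\<omega> k))) \<partial>sphere_measure)"
      by simp
    also have "\<dots> = (\<Sum>a\<le>k. \<Sum>b\<le>k. (of_nat (k choose a) * of_real x ^ (k - a) * (of_nat (k choose b) * of_real x ^ (k - b))) * (\<integral>z. vec_power z (\<omega> a) * cnj (vec_power z (\<omega> b)) \<partial>sphere_measure))"
      unfolding exp2
      by (subst Bochner_Integration.integral_sum | intro sum.cong refl Bochner_Integration.integrable_sum
            integrable_mult_right integrable_sphere_measure_monomial Bochner_Integration.integral_mult_right_zero)+
    also have "\<dots> = (\<Sum>a\<le>k. \<Sum>b\<le>k. if b = a then (of_nat (k choose a) * of_real x ^ (k - a)) * (of_nat (k choose a) * of_real x ^ (k - a)) * sphere_moment (\<omega> a) else 0)"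
      using inj by (intro sum.cong refl) (auto simp: sphere_moment_orthogonal sphere_moment_def)
    also have "\<dots> = (\<Sum>a\<le>k. of_nat (k choose a) * (of_nat (k choose a) * sphere_moment (\<omega> a)) * of_real y ^ (k - a))"
      unfolding xy(1)[symmetric] by (simp add: power2_eq_square power_mult_distrib mult_ac)
    finally show ?thesis
      by (simp add: binomial_ring sum_distrib_left sum_distrib_right mult_ac)
  qed
  \<comment> \<open>The coefficient of \<open>y ^ r\<close> in the difference of the two sides of
    \<open>key\<close>; the polynomial vanishes at every nonnegative real and hence
    identically.\<close>
  define c where "c r = of_nat (k choose (k - r)) * (of_nat (k choose (k - r)) * sphere_moment (\<omega> (k - r)) - sphere_moment (\<omega> k))" for r
  have c0: "(\<Sum>r\<le>k. c r * of_real y ^ r) = 0" if "y \<ge> 0" for y :: real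
  proof -
    have "(\<Sum>r\<le>k. c r * of_real y ^ r) = (\<Sum>a\<le>k. c (k - a) * of_real y ^ (k - a))"
      by (rule sum.reindex_bij_witness[of _ "\<lambda>a. k - a" "\<lambda>a. k - a"]) auto
    also have "\<dots> = 0"
      using key[OF that] by (simp add: c_def right_diff_distrib left_diff_distrib sum_subtractf mult_ac)
    finally show ?thesis .
  qed
  have "infinite (complex_of_real ` {0..})"
    by (subst finite_image_iff) (auto simp: inj_on_def infinite_Ici)
  moreover have "complex_of_real ` {0..} \<subseteq> {z. (\<Sum>r\<le>k. c r * z ^ r) = 0}"
    using c0 by auto
  ultimately have "infinite {z. (\<Sum>r\<le>k. c r * z ^ r) = 0}"
    using infinite_super by blast
  then have "c (k - a) = 0"
    using polyfun_finite_roots[of c k] by auto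
  then show ?thesis
    using \<open>a \<le> k\<close> ij by (auto simp: c_def \<omega>_def fun_upd_twist)
qed

text \<open>Both moments have the same total degree \<open>k\<close> in the coordinates
  \<open>i\<close> and \<open>j\<close>, so each is the same number divided by a binomial
  coefficient; the two coefficients are neighbours in row \<open>k\<close> of Pascal's
  triangle.\<close>

lemma sphere_moment_exchange:
  fixes \<beta> :: "'n :: finite \<Rightarrow> nat"
  shows "of_nat (Suc (\<beta> j)) * sphere_moment (\<beta>(i := Suc (\<beta> i))) = of_nat (Suc (\<beta> i)) * sphere_moment (\<beta>(j := Suc (\<beta> j)))"
proof (cases "i = j")
  case False
  define k where "k = Suc (\<beta> i + \<beta> j)"
  define X where "X = sphere_moment (\<beta>(i := Suc (\<beta> i)))"
  define Y where "Y = sphere_moment (\<beta>(j := Suc (\<beta> j)))"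
  have upd: "\<beta>(i := Suc (\<beta> i), j := k - Suc (\<beta> i)) = \<beta>(i := Suc (\<beta> i))"
            "\<beta>(i := \<beta> i, j := k - \<beta> i) = \<beta>(j := Suc (\<beta> j))"
    using False by (auto simp: k_def fun_eq_iff)
  have "of_nat (k choose Suc (\<beta> i)) * X = of_nat (k choose \<beta> i) * Y"
    using sphere_moment_two_coordinates[OF False, of "Suc (\<beta> i)" k \<beta>]
          sphere_moment_two_coordinates[OF False, of "\<beta> i" k \<beta>]
    unfolding upd X_def Y_def by (simp add: k_def)
  moreover have "Suc (\<beta> i) * (k choose Suc (\<beta> i)) = Suc (\<beta> j) * (k choose \<beta> i)"
    using binomial_absorb_comp[of k "\<beta> i"] binomial_absorption[of "\<beta> i" k] by (simp add: k_def)
  then have "of_nat (Suc (\<beta> i)) * of_nat (k choose Suc (\<beta> i)) = (of_nat (Suc (\<beta> j)) * of_nat (k choose \<beta> i) :: complex)"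
    by (simp only: of_nat_mult[symmetric])
  moreover have "k choose \<beta> i > 0"
    by (simp add: k_def)
  then have "(of_nat (k choose \<beta> i) :: complex) \<noteq> 0"
    by simp
  ultimately have "of_nat (k choose \<beta> i) * (of_nat (Suc (\<beta> j)) * X) = of_nat (k choose \<beta> i) * (of_nat (Suc (\<beta> i)) * Y)"
    by (metis (no_types, lifting) mult.assoc mult.left_commute)
  then show ?thesis
    using \<open>(of_nat (k choose \<beta> i) :: complex) \<noteq> 0\<close> unfolding X_def Y_def by (simp only: mult_cancel_left simp_thms)
qed simp

text \<open>The integrand is multiplied by the sum of all |z_j|^2, which is 1 on the sphere.\<close>

lemma sphere_moment_sum:
  fixes \<beta> :: "'n :: finite \<Rightarrow> nat"
  shows "sphere_moment \<beta> = (\<Sum>j\<in>UNIV. sphere_moment (\<beta>(j := Suc (\<beta> j))))"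
proof -
  have "vec_power z \<beta> * cnj (vec_power z \<beta>) =
     (\<Sum>j\<in>UNIV. vec_power z (\<beta>(j := Suc (\<beta> j))) * cnj (vec_power z (\<beta>(j := Suc (\<beta> j)))))"
    if "norm z = 1" for z :: "complex ^ 'n"
  proof -
    have "(\<Sum>j\<in>UNIV. vec_power z (\<beta>(j := Suc (\<beta> j))) * cnj (vec_power z (\<beta>(j := Suc (\<beta> j))))) =
      (\<Sum>j\<in>UNIV. z $ j * cnj (z $ j)) * (vec_power z \<beta> * cnj (vec_power z \<beta>))"
      unfolding vec_power_Suc sum_distrib_right by (intro sum.cong) (simp_all add: mult_ac)
    also have "(\<Sum>j\<in>UNIV. z $ j * cnj (z $ j)) = of_real ((norm z)\<^sup>2)"
      unfolding norm_vec_complex_sq of_real_sum complex_norm_square ..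
    finally show ?thesis by (simp only: that power_one of_real_1 mult_1_left)
  qed
  then have "sphere_moment \<beta> = (\<integral>z. (\<Sum>j\<in>UNIV. vec_power z (\<beta>(j := Suc (\<beta> j))) * cnj (vec_power z (\<beta>(j := Suc (\<beta> j))))) \<partial>sphere_measure)"
    unfolding sphere_moment_def by (intro Bochner_Integration.integral_cong) auto
  then show ?thesis
    unfolding sphere_moment_def
    by (simp only: Bochner_Integration.integral_sum[OF integrable_sphere_measure_monomial])
qed

lemma multi_coeff_pos: "multi_coeff \<omega> > 0"
  by (simp add: multi_coeff_def prod_pos)

text \<open>The recursion that the moments satisfy as well; together with the value 1 at the zero
  index it identifies the two.\<close>

lemma multi_coeff_Suc:
  fixes \<beta> :: "'n :: finite \<Rightarrow> nat"
  shows "multi_coeff (\<beta>(i := Suc (\<beta> i))) = real (Suc (\<beta> i)) / real (CARD('n) + sum \<beta> UNIV) * multi_coeff \<beta>"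
proof -
  have 1: "(\<Prod>j\<in>UNIV. fact ((\<beta>(i := Suc (\<beta> i))) j)) = real (Suc (\<beta> i)) * (\<Prod>j\<in>UNIV. fact (\<beta> j))"
    by (subst (1 2) prod.remove[of UNIV i]) (auto simp: algebra_simps)
  have 2: "sum (\<beta>(i := Suc (\<beta> i))) UNIV = Suc (sum \<beta> UNIV)"
    by (subst (1 2) sum.remove[of UNIV i]) auto
  \<comment> \<open>The dimension is at least 1, so the truncated \<open>CARD('n) - 1\<close> is a
    genuine predecessor.\<close>
  obtain m where "CARD('n) = Suc m"
    using not0_implies_Suc[OF zero_less_card_finite[THEN less_imp_neq, symmetric]] by blast
  then have 3: "fact (CARD('n) - 1 + Suc (sum \<beta> UNIV)) = real (CARD('n) + sum \<beta> UNIV) * fact (CARD('n) - 1 + sum \<beta> UNIV)"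
    by (simp add: algebra_simps)
  show ?thesis
    unfolding multi_coeff_def 1 2 3 by simp
qed

text \<open>Induction on the degree: lower one coordinate \<open>i\<close> to get \<gamma>, expand
  the moment of \<gamma> by \<open>sphere_moment_sum\<close>, and let the exchange law turn every
  term into a multiple of the moment of \<beta>. The factors \<open>\<gamma> j + 1\<close> add up to
  the dimension plus the degree of \<gamma>.\<close>

lemma sphere_moment_eq:
  fixes \<beta> :: "'n :: finite \<Rightarrow> nat"
  shows "sphere_moment \<beta> = of_real (multi_coeff \<beta>)"
proof (induction "sum \<beta> UNIV" arbitrary: \<beta>)
  case 0
  then have "\<beta> = (\<lambda>_. 0)" by auto
  moreover have "measure sphere_measure (sphere (0 :: complex ^ 'n) 1) = 1"
    using sphere_measure.prob_space by simp
  ultimately show ?case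
    by (simp add: sphere_moment_def vec_power_def multi_coeff_def)
next
  case (Suc m)
  then obtain i where "\<beta> i \<noteq> 0"
    by (metis (no_types, lifting) UNIV_I nat.distinct(1) sum.neutral)
  then obtain b where b: "\<beta> i = Suc b" by (cases "\<beta> i") auto
  define \<gamma> where "\<gamma> = \<beta>(i := b)"
  have \<beta>: "\<beta> = \<gamma>(i := Suc (\<gamma> i))"
    by (auto simp: \<gamma>_def b)
  have "sum \<beta> UNIV = Suc (sum \<gamma> UNIV)"
    unfolding \<beta> by (subst (1 2) sum.remove[of UNIV i]) auto
  then have IH: "sphere_moment \<gamma> = of_real (multi_coeff \<gamma>)"
    using Suc by simp
  have "of_nat (Suc (\<gamma> i)) * sphere_moment \<gamma> = (\<Sum>j\<in>UNIV. of_nat (Suc (\<gamma> j)) * sphere_moment \<beta>)"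
    unfolding \<beta> sphere_moment_exchange[of \<gamma> _ i] by (subst sphere_moment_sum) (simp add: sum_distrib_left)
  also have "\<dots> = of_nat (CARD('n) + sum \<gamma> UNIV) * sphere_moment \<beta>"
    by (simp add: sum_distrib_right[symmetric] sum.distrib)
  finally have "sphere_moment \<beta> = of_nat (Suc (\<gamma> i)) * sphere_moment \<gamma> / of_nat (CARD('n) + sum \<gamma> UNIV)"
    by (simp add: field_simps del: of_nat_Suc of_nat_add)
  then show ?case
    unfolding IH by (subst (2) \<beta>) (simp add: multi_coeff_Suc)
qed

subsection \<open>Powers of integrable functions\<close>

text \<open>The graph of the convex function \<open>x powr p\<close> lies above its tangent at
  \<open>c\<close>. Convexity and the derivative are taken on the open half-line, so
  \<open>x = 0\<close> is a separate case.\<close>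

lemma powr_ge_tangent:
  fixes c x p :: real
  assumes "1 \<le> p" "0 < c" "0 \<le> x"
  shows "c powr p + p * c powr (p - 1) * (x - c) \<le> x powr p"
proof (cases "x = 0")
  case True
  have "c powr p = c * c powr (p - 1)"
    using assms by (metis powr_mult_base diff_add_cancel add.commute order.strict_implies_order)
  then show ?thesis
    using True assms by (simp add: mult_right_mono algebra_simps)
next
  case False
  have "x powr p - c powr p \<ge> (p * c powr (p - 1)) * (x - c)"
    by (rule convex_on_imp_above_tangent[of "{0<..}"])
       (use False assms powr_convex in \<open>auto intro!: derivative_eq_intros simp: interior_open\<close>)
  then show ?thesis by simp
qed

text \<open>Jensen's inequality for the probability density \<open>w\<close>: the tangent inequality
  at the weighted mean \<open>c\<close> is integrated, and its linear term cancels. It serves with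
  the constant weight 1 and with the zonal kernel as weight.\<close>

lemma weighted_integral_powr_le:
  fixes X w :: "'a \<Rightarrow> real"
  assumes p: "1 \<le> p" and X: "\<And>x. x \<in> space M \<Longrightarrow> 0 \<le> X x" "integrable M (\<lambda>x. w x * X x)" "integrable M (\<lambda>x. w x * X x powr p)"
    and w: "\<And>x. x \<in> space M \<Longrightarrow> 0 \<le> w x" "integrable M w" "(\<integral>x. w x \<partial>M) = 1"
  shows "(\<integral>x. w x * X x \<partial>M) powr p \<le> (\<integral>x. w x * X x powr p \<partial>M)"
proof (cases "(\<integral>x. w x * X x \<partial>M) = 0")
  case True
  then show ?thesis using w(1) by (simp add: Bochner_Integration.integral_nonneg)
next
  case False
  define c where "c = (\<integral>x. w x * X x \<partial>M)"
  have "c \<ge> 0"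
    unfolding c_def using X(1) w(1) by (intro Bochner_Integration.integral_nonneg) auto
  then have "c > 0"
    using False by (simp add: c_def)
  have "c powr p = (c powr p - p * c powr (p - 1) * c) * (\<integral>x. w x \<partial>M) + p * c powr (p - 1) * (\<integral>x. w x * X x \<partial>M)"
    by (simp add: w(3) flip: c_def)
  also have "\<dots> = (\<integral>x. (c powr p - p * c powr (p - 1) * c) * w x + p * c powr (p - 1) * (w x * X x) \<partial>M)"
    using X w by simp
  also have "\<dots> = (\<integral>x. w x * (c powr p + p * c powr (p - 1) * (X x - c)) \<partial>M)"
    by (simp add: algebra_simps)
  also have "\<dots> \<le> (\<integral>x. w x * X x powr p \<partial>M)"
  proof (rule integral_mono)
    have "integrable M (\<lambda>x. (c powr p - p * c powr (p - 1) * c) * w x + p * c powr (p - 1) * (w x * X x))"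
      using X w by auto
    then show "integrable M (\<lambda>x. w x * (c powr p + p * c powr (p - 1) * (X x - c)))"
      by (simp add: algebra_simps)
  qed (use X w powr_ge_tangent[OF p \<open>c > 0\<close>] in \<open>auto intro!: mult_left_mono\<close>)
  finally show ?thesis by (simp add: c_def)
qed

lemma le_one_plus_powr:
  fixes x p :: real
  assumes "1 \<le> p" "0 \<le> x"
  shows "x \<le> 1 + x powr p"
proof (cases "x \<le> 1")
  case False
  then have "x powr 1 \<le> x powr p" using assms by (intro powr_mono) auto
  then show ?thesis using False by simp
qed (use powr_ge_zero[of x p] in linarith)

section \<open>\<open>L\<^sup>p\<close> over finite measures: inclusion in \<open>L\<^sup>1\<close>
  and vector space operations\<close>

lemma Lp_space_integrable:
  assumes "finite_measure M" "1 \<le> p" "f \<in> Lp_space M p"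
  shows "integrable M f"
proof -
  interpret finite_measure M by fact
  have "integrable M (\<lambda>x. 1 + norm (f x) powr p)"
    using assms by (auto simp: Lp_space_def)
  then show ?thesis
    by (rule Bochner_Integration.integrable_bound)
       (use assms le_one_plus_powr[of p] in \<open>auto simp: Lp_space_def intro!: AE_I2\<close>)
qed

lemma (in prob_space) expectation_le_Lp_norm:
  assumes p: "1 \<le> p" and f: "f \<in> Lp_space M p"
  shows "expectation (\<lambda>x. norm (f x)) \<le> Lp_norm M p f"
proof -
  have "expectation (\<lambda>x. norm (f x)) powr p \<le> expectation (\<lambda>x. norm (f x) powr p)"
    using Lp_space_integrable[OF finite_measure_axioms p f] p f
    using weighted_integral_powr_le[OF p, of M "\<lambda>x. norm (f x)" "\<lambda>_. 1"]
    by (auto simp: Lp_space_def prob_space)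
  then have "(expectation (\<lambda>x. norm (f x)) powr p) powr (1 / p) \<le> Lp_norm M p f"
    unfolding Lp_norm_def using p by (intro powr_mono2) auto
  then show ?thesis using p by (simp add: powr_powr)
qed

text \<open>Takes the place of Minkowski's inequality: the factor \<open>2 powr p\<close> is
  harmless where errors can be made arbitrarily small.\<close>

lemma norm_add_powr_le:
  fixes a b :: "'a :: real_normed_vector"
  assumes "0 \<le> p"
  shows "norm (a + b) powr p \<le> 2 powr p * (norm a powr p + norm b powr p)"
proof -
  have "norm (a + b) powr p \<le> (2 * max (norm a) (norm b)) powr p"
    using assms norm_triangle_ineq[of a b] by (intro powr_mono2) auto
  also have "\<dots> = 2 powr p * max (norm a) (norm b) powr p"
    by (simp add: powr_mult)
  also have "max (norm a) (norm b) powr p \<le> norm a powr p + norm b powr p"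
    by (auto simp: max_def)
  finally show ?thesis by simp
qed

lemma Lp_space_add:
  assumes "0 \<le> p" "f \<in> Lp_space M p" "g \<in> Lp_space M p"
  shows "(\<lambda>x. f x + g x) \<in> Lp_space M p"
proof -
  have "integrable M (\<lambda>x. norm (f x + g x) powr p)"
    by (rule Bochner_Integration.integrable_bound[where f = "\<lambda>x. 2 powr p * (norm (f x) powr p + norm (g x) powr p)"])
       (use assms norm_add_powr_le[OF assms(1)] in \<open>auto simp: Lp_space_def intro!: AE_I2\<close>)
  then show ?thesis using assms by (auto simp: Lp_space_def)
qed

lemma Lp_space_uminus: "f \<in> Lp_space M p \<Longrightarrow> (\<lambda>x. - f x) \<in> Lp_space M p"
  by (auto simp: Lp_space_def)

lemma Lp_space_diff:
  assumes "0 \<le> p" "f \<in> Lp_space M p" "g \<in> Lp_space M p"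
  shows "(\<lambda>x. f x - g x) \<in> Lp_space M p"
  using Lp_space_add[OF assms(1,2) Lp_space_uminus[OF assms(3)]] by simp

lemma (in finite_measure) bounded_in_Lp_space:
  assumes "f \<in> borel_measurable M" "\<And>x. x \<in> space M \<Longrightarrow> norm (f x) \<le> B" "0 \<le> p"
  shows "f \<in> Lp_space M p"
proof -
  have "integrable M (\<lambda>x. norm (f x) powr p)"
    using assms by (intro integrable_const_bound[where B = "B powr p"]) (auto intro!: AE_I2 powr_mono2)
  then show ?thesis using assms by (simp add: Lp_space_def)
qed

lemma continuous_on_in_Lp_space:
  fixes f :: "complex ^ 'n \<Rightarrow> complex"
  assumes "continuous_on (sphere 0 1) f" "0 \<le> p"
  shows "f \<in> Lp_space sphere_measure p"
proof -
  have "bounded (f ` sphere 0 1)"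
    using assms by (intro compact_imp_bounded compact_continuous_image) auto
  then obtain B where "\<And>z. norm z = 1 \<Longrightarrow> norm (f z) \<le> B"
    unfolding bounded_iff by (metis image_eqI mem_sphere_0)
  then show ?thesis
    using assms borel_measurable_sphere_measure_continuous_on
    by (intro sphere_measure.bounded_in_Lp_space[where B = B]) auto
qed

lemma sphere_algebra_continuous_on:
  assumes "g \<in> sphere_algebra" shows "continuous_on (sphere 0 1) g"
proof -
  obtain G where G: "continuous_on (cball 0 1) G" "\<forall>z\<in>sphere 0 1. g z = G z"
    using assms by (auto simp: sphere_algebra_def)
  have "continuous_on (sphere 0 1) G"
    using G(1) sphere_cball continuous_on_subset by blast
  then show ?thesis
    by (rule continuous_on_eq) (use G in auto)
qed

lemma integrable_sphere_measure_continuous_mult: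
  fixes f \<phi> :: "complex ^ 'n \<Rightarrow> complex"
  assumes \<phi>: "continuous_on (sphere 0 1) \<phi>" and f: "integrable sphere_measure f"
  shows "integrable sphere_measure (\<lambda>z. \<phi> z * f z)"
proof -
  have "bounded (\<phi> ` sphere 0 1)"
    using \<phi> by (intro compact_imp_bounded compact_continuous_image) auto
  then obtain B where B: "B > 0" "\<And>z. norm z = 1 \<Longrightarrow> norm (\<phi> z) \<le> B"
    unfolding bounded_pos by (metis image_eqI mem_sphere_0)
  have [measurable]: "\<phi> \<in> borel_measurable sphere_measure"
    using \<phi> by (rule borel_measurable_sphere_measure_continuous_on)
  show ?thesis
  proof (rule Bochner_Integration.integrable_bound)
    show "integrable sphere_measure (\<lambda>z. B * norm (f z))" using f by auto
    show "(\<lambda>z. \<phi> z * f z) \<in> borel_measurable sphere_measure" using f by measurable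
    show "AE z in sphere_measure. norm (\<phi> z * f z) \<le> norm (B * norm (f z))"
      using B by (auto intro!: AE_I2 mult_right_mono simp: norm_mult)
  qed
qed

text \<open>Integration against a continuous \<phi> is bounded on \<open>L\<^sup>p\<close>, since
  \<phi> is bounded and the \<open>L\<^sup>1\<close> norm is at most the \<open>L\<^sup>p\<close>
  norm on a probability space. Its kernel is closed, hence contains \<open>H\<^sup>p\<close> once it
  contains A(S). Each moment condition is the vanishing of one such functional.\<close>

lemma Hardy_space_annihilator:
  fixes f \<phi> :: "complex ^ 'n \<Rightarrow> complex"
  assumes p: "1 \<le> p" and f: "f \<in> Hardy_space p" and \<phi>: "continuous_on (sphere 0 1) \<phi>"
    and 0: "\<And>g. g \<in> sphere_algebra \<Longrightarrow> (\<integral>z. \<phi> z * g z \<partial>sphere_measure) = 0"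
  shows "(\<integral>z. \<phi> z * f z \<partial>sphere_measure) = 0"
proof -
  have "bounded (\<phi> ` sphere 0 1)"
    using \<phi> by (intro compact_imp_bounded compact_continuous_image) auto
  then obtain B where B: "B > 0" "\<And>z. norm z = 1 \<Longrightarrow> norm (\<phi> z) \<le> B"
    unfolding bounded_pos by (metis image_eqI mem_sphere_0)
  note int = integrable_sphere_measure_continuous_mult[OF \<phi>]
  have fL: "f \<in> Lp_space sphere_measure p" using f by (simp add: Hardy_space_def)
  have "norm (\<integral>z. \<phi> z * f z \<partial>sphere_measure) \<le> B * \<epsilon>" if \<epsilon>: "\<epsilon> > 0" for \<epsilon>
  proof -
    obtain g :: "complex ^ 'n \<Rightarrow> complex" where g: "g \<in> sphere_algebra" "Lp_norm sphere_measure p (\<lambda>z. f z - g z) < \<epsilon>"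
      using f \<epsilon> unfolding Hardy_space_def by blast
    have gL: "g \<in> Lp_space sphere_measure p"
      using continuous_on_in_Lp_space[OF sphere_algebra_continuous_on[OF g(1)]] p by simp
    have fgL: "(\<lambda>z. f z - g z) \<in> Lp_space sphere_measure p"
      using Lp_space_diff[OF _ fL gL] p by simp
    note integ = Lp_space_integrable[OF sphere_measure.finite_measure_axioms p]
    have "(\<integral>z. \<phi> z * f z \<partial>sphere_measure) = (\<integral>z. \<phi> z * (f z - g z) \<partial>sphere_measure)"
      using int[OF integ[OF fL]] int[OF integ[OF gL]] 0[OF g(1)] by (simp add: right_diff_distrib)
    also have "norm \<dots> \<le> (\<integral>z. norm (\<phi> z * (f z - g z)) \<partial>sphere_measure)"
      by (rule integral_norm_bound)
    also have "\<dots> \<le> (\<integral>z. B * norm (f z - g z) \<partial>sphere_measure)"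
      using B
      by (intro integral_mono integrable_norm integrable_mult_right int integ fgL)
         (auto intro!: mult_right_mono simp: norm_mult)
    also have "\<dots> = B * (\<integral>z. norm (f z - g z) \<partial>sphere_measure)"
      by simp
    also have "\<dots> \<le> B * \<epsilon>"
      using sphere_measure.expectation_le_Lp_norm[OF p fgL] g(2) B by (intro mult_left_mono) auto
    finally show ?thesis .
  qed
  then have "norm (\<integral>z. \<phi> z * f z \<partial>sphere_measure) \<le> 0 + \<epsilon>" if "\<epsilon> > 0" for \<epsilon>
    using B that by (metis add_0 divide_pos_pos nonzero_mult_div_cancel_left order_less_irrefl times_divide_eq_right)
  then have "norm (\<integral>z. \<phi> z * f z \<partial>sphere_measure) \<le> 0"
    by (rule field_le_epsilon)
  then show ?thesis by simp
qed

subsection \<open>Fourier coefficients in one coordinate\<close>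

text \<open>With \<open>circ\<close> as parametrization this is the circle with normalized arc
  length, in a form that allows products with \<open>sphere_measure\<close> and with itself.\<close>

abbreviation unit_interval :: "real measure" where
  "unit_interval \<equiv> restrict_space lborel {0..1}"

abbreviation circ :: "real \<Rightarrow> complex" where
  "circ t \<equiv> cis (2 * pi * t)"

interpretation unit_interval: prob_space unit_interval
  by standard (simp add: emeasure_restrict_space space_restrict_space)

lemma measurable_unit_interval_borel [measurable (raw)]:
  "f \<in> measurable borel N \<Longrightarrow> f \<in> measurable unit_interval N"
  by (rule measurable_restrict_space1) simp

text \<open>The factors of the product spaces carry restricted \<sigma>-algebras; reading the
  projections as Borel maps into the ambient type makes the integrands of the Fubini arguments
  measurable by composition.\<close>

lemma fst_snd_restrict_space_measurable [measurable]:
  "fst \<in> borel_measurable (restrict_space borel A \<Otimes>\<^sub>M N)"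
  "snd \<in> borel_measurable (N \<Otimes>\<^sub>M restrict_space borel A)"
  "fst \<in> borel_measurable (restrict_space lborel B \<Otimes>\<^sub>M N)"
  "snd \<in> borel_measurable (N \<Otimes>\<^sub>M restrict_space lborel B)"
  "fst \<in> borel_measurable ((sphere_measure :: (complex ^ 'n) measure) \<Otimes>\<^sub>M N)"
  "snd \<in> borel_measurable (N \<Otimes>\<^sub>M (sphere_measure :: (complex ^ 'n) measure))"
  by (rule measurable_compose[OF measurable_fst] measurable_compose[OF measurable_snd],
      simp add: measurable_restrict_space1 measurable_sphere_measure_borel)+

lemma cnj_measurable [measurable]: "cnj \<in> borel_measurable borel"
  by (intro borel_measurable_continuous_onI continuous_intros)

lemma cis_measurable [measurable]: "cis \<in> borel_measurable borel"
  by (intro borel_measurable_continuous_onI continuous_intros)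

lemma continuous_on_coord_mult [continuous_intros]:
  assumes "continuous_on A f" "continuous_on A g"
  shows "continuous_on A (\<lambda>x. coord_mult j (f x) (g x))"
  unfolding coord_mult_def
proof (rule continuous_on_vec_lambda)
  show "continuous_on A (\<lambda>x. if i = j then f x * g x $ i else g x $ i)" for i
    using assms by (cases "i = j") (auto intro!: continuous_intros)
qed

lemma coord_mult_measurable [measurable (raw)]:
  fixes g :: "'a \<Rightarrow> complex ^ 'n"
  assumes "f \<in> borel_measurable M" "g \<in> borel_measurable M"
  shows "(\<lambda>x. coord_mult j (f x) (g x)) \<in> borel_measurable M"
proof -
  have "continuous_on UNIV (\<lambda>x :: complex \<times> (complex ^ 'n). coord_mult j (fst x) (snd x))"
    by (intro continuous_intros)
  then show ?thesis
    using borel_measurable_continuous_Pair[OF assms, of "coord_mult j"] by simp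
qed

text \<open>Cauchy's formula for the m-th derivative at 0 with the contour on the boundary of the
  disc, where \<open>h\<close> is merely continuous. On the circle 1 / u = cnj u, so du / (2 pi i u)
  becomes normalized arc length.\<close>

lemma circle_integral_Cauchy:
  assumes h: "continuous_on (cball 0 1) h" "h holomorphic_on ball 0 1"
  shows "(\<integral>t. cnj (circ t) ^ m * h (circ t) \<partial>unit_interval) = (deriv ^^ m) h 0 / fact m"
proof -
  have c: "circlepath 0 1 t = circ t" for t
    by (simp add: circlepath cis_conv_exp mult_ac)
  have "((\<lambda>t. h (circ t) / circ t ^ Suc m * (2 * pi * \<i> * circ t)) has_integral
      (2 * pi * \<i>) / (fact m) * (deriv ^^ m) h 0) {0..1}"
    using Cauchy_has_contour_integral_higher_derivative_circlepath[OF h centre_in_ball[THEN iffD2, OF zero_less_one], of m]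
    unfolding has_contour_integral_def
    by (rule has_integral_eq[rotated])
       (simp only: vector_derivative_circlepath01 atLeastAtMost_iff, simp add: c cis_conv_exp mult_ac)
  then have "((\<lambda>t. (2 * pi * \<i>) * (cnj (circ t) ^ m * h (circ t))) has_integral
      (2 * pi * \<i>) * ((deriv ^^ m) h 0 / fact m)) {0..1}"
    by (rule has_integral_eq_rhs[OF has_integral_eq[rotated]])
       (simp_all add: field_simps cis_cnj flip: cis_inverse)
  then have "((\<lambda>t. (1 / (2 * pi * \<i>)) * ((2 * pi * \<i>) * (cnj (circ t) ^ m * h (circ t)))) has_integral
      (1 / (2 * pi * \<i>)) * ((2 * pi * \<i>) * ((deriv ^^ m) h 0 / fact m))) {0..1}"
    by (rule has_integral_mult_right)
  then have *: "integral {0..1} (\<lambda>t. cnj (circ t) ^ m * h (circ t)) = (deriv ^^ m) h 0 / fact m"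
    by (simp add: integral_unique)
  have "continuous_on {0..1} (\<lambda>t. cnj (circ t) ^ m * h (circ t))"
    by (intro continuous_intros continuous_on_compose2[OF h(1)]) auto
  then have "set_integrable lborel {0..1} (\<lambda>t. cnj (circ t) ^ m * h (circ t))"
    by (rule borel_integrable_atLeastAtMost')
  then show ?thesis
    using * set_borel_integral_eq_integral(2)[of "{0..1}" "\<lambda>t. cnj (circ t) ^ m * h (circ t)"]
    by (simp add: integral_restrict_space set_lebesgue_integral_def)
qed

text \<open>The mean value property of \<open>u ^ m * h u\<close>, which vanishes at 0.\<close>

lemma circle_integral_Cauchy_0:
  assumes h: "continuous_on (cball 0 1) h" "h holomorphic_on ball 0 1" and "m > 0"
  shows "(\<integral>t. circ t ^ m * h (circ t) \<partial>unit_interval) = 0"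
  using circle_integral_Cauchy[of "\<lambda>u. u ^ m * h u" 0] assms
  by (simp add: continuous_on_mult continuous_on_power holomorphic_on_mult holomorphic_on_power)

text \<open>The strict inequality moves points of the sphere into the open ball, where holomorphy is
  available.\<close>

lemma norm_coord_mult_less:
  fixes z :: "complex ^ 'n"
  assumes "norm w < 1" "z $ j \<noteq> 0"
  shows "norm (coord_mult j w z) < norm z"
proof -
  have *: "(norm (v :: complex ^ 'n))\<^sup>2 = (norm (v $ j))\<^sup>2 + (\<Sum>l\<in>UNIV - {j}. (norm (v $ l))\<^sup>2)" for v
    unfolding norm_vec_complex_sq by (simp add: sum.remove[of UNIV j])
  have "norm w * norm (z $ j) < norm (z $ j)"
    using assms by simp
  then have "(norm (coord_mult j w z))\<^sup>2 < (norm z)\<^sup>2"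
    by (simp add: * norm_mult power_strict_mono)
  then show ?thesis
    by (rule power2_less_imp_less) simp
qed

text \<open>Boundary points \<open>z\<close> are included: for |w| < 1 the slice runs inside the
  open ball unless \<open>z $ j = 0\<close>, in which case it is constant. The two conclusions are
  the hypotheses of Cauchy's formula on the closed disc.\<close>

lemma sep_holomorphic_coord_mult:
  fixes G :: "complex ^ 'n \<Rightarrow> complex"
  assumes G: "continuous_on (cball 0 1) G" "sep_holomorphic_on_ball G" and z: "norm z \<le> 1"
  shows "continuous_on (cball 0 1) (\<lambda>w. G (coord_mult j w z))"
    and "(\<lambda>w. G (coord_mult j w z)) holomorphic_on ball 0 1"
proof -
  have nz: "norm (coord_mult j w z) \<le> 1" if "norm w \<le> 1" for w
    using norm_coord_mult_le[OF that, of j z] z by simp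
  have "continuous_on (cball 0 1) (\<lambda>w. coord_mult j w z)"
    by (intro continuous_intros)
  then show "continuous_on (cball 0 1) (\<lambda>w. G (coord_mult j w z))"
    by (rule continuous_on_compose2[OF G(1)]) (use nz in auto)
  show "(\<lambda>w. G (coord_mult j w z)) holomorphic_on ball 0 1"
  proof (cases "z $ j = 0")
    case True
    then have "coord_mult j w z = z" for w by (simp add: vec_eq_iff)
    then show ?thesis by simp
  next
    case False
    \<comment> \<open>Separate holomorphy is stated for base points in the open ball and for the
      coordinate itself as variable. The base point is therefore moved to
      \<open>coord_mult j 0 z\<close>, and the scaling \<open>w * z $ j\<close> is composed
      afterwards.\<close>
    let ?e = "\<lambda>w. (\<chi> i. if i = j then w else coord_mult j 0 z $ i)"
    have e: "?e (w * z $ j) = coord_mult j w z" for w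
      by (simp add: vec_eq_iff)
    have "coord_mult j 0 z \<in> ball 0 1"
      using norm_coord_mult_less[of 0 z j] False z by simp
    then have "(\<lambda>w. G (?e w)) holomorphic_on {w. ?e w \<in> ball 0 1}"
      using G(2) by (auto simp: sep_holomorphic_on_ball_def)
    moreover have "(\<lambda>w. w * z $ j) ` ball 0 1 \<subseteq> {w. ?e w \<in> ball 0 1}"
      using norm_coord_mult_less[OF _ False] z by (force simp: e)
    ultimately have "((\<lambda>w. G (?e w)) \<circ> (\<lambda>w. w * z $ j)) holomorphic_on ball 0 1"
      by (intro holomorphic_on_compose_gen) (auto intro!: holomorphic_intros)
    then show ?thesis by (simp add: o_def e)
  qed
qed

text \<open>The m-th Fourier coefficient of the circle action on coordinate \<open>j\<close>; for a
  holomorphic \<open>G\<close> it is the part of \<open>G\<close> of degree \<open>m\<close> in that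
  coordinate.\<close>

definition coord_coeff :: "'n :: finite \<Rightarrow> nat \<Rightarrow> (complex ^ 'n \<Rightarrow> complex) \<Rightarrow> complex ^ 'n \<Rightarrow> complex" where
  "coord_coeff j m G z = (\<integral>t. cnj (circ t) ^ m * G (coord_mult j (circ t) z) \<partial>unit_interval)"

text \<open>The factor \<open>w\<close> ranges over the closed disc, not just over the circle. This
  records holomorphy in coordinate \<open>j\<close> and later permits to take the coordinates of an
  arbitrary point of the ball as factors.\<close>

definition coord_homogeneous :: "'n :: finite \<Rightarrow> nat \<Rightarrow> (complex ^ 'n \<Rightarrow> complex) \<Rightarrow> bool" where
  "coord_homogeneous j m G \<longleftrightarrow>
     (\<forall>z w. norm z \<le> 1 \<longrightarrow> norm w \<le> 1 \<longrightarrow> G (coord_mult j w z) = w ^ m * G z)"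

lemma coord_homogeneousD:
  "coord_homogeneous j m G \<Longrightarrow> norm z \<le> 1 \<Longrightarrow> norm w \<le> 1 \<Longrightarrow> G (coord_mult j w z) = w ^ m * G z"
  by (simp add: coord_homogeneous_def)

text \<open>A class of total functions that is stable under \<open>coord_coeff\<close> and suffices
  for Fubini's theorem.\<close>

definition bounded_borel :: "(complex ^ 'n \<Rightarrow> complex) \<Rightarrow> bool" where
  "bounded_borel G \<longleftrightarrow> G \<in> borel_measurable borel \<and> bounded (range G)"

lemma bounded_borelE:
  assumes "bounded_borel G"
  obtains B where "G \<in> borel_measurable borel" "\<And>z. norm (G z) \<le> B" "B \<ge> 0"
proof -
  from assms obtain B where B: "\<And>z. norm (G z) \<le> B"
    by (auto simp: bounded_borel_def bounded_iff)
  moreover have "B \<ge> 0" using B[of undefined] norm_ge_zero order_trans by blast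
  ultimately show ?thesis using that assms by (auto simp: bounded_borel_def)
qed

text \<open>By Cauchy's formula the coefficient is an m-th derivative at 0 of a slice; replacing the
  variable \<open>u\<close> by \<open>w * u\<close> brings out \<open>w ^ m\<close>.
  \<open>H\<close> is a total function that agrees on the closed ball with the holomorphic
  \<open>G\<close>.\<close>

lemma coord_coeff_homogeneous:
  assumes G: "continuous_on (cball 0 1) G" "sep_holomorphic_on_ball G"
    and H: "\<And>z. norm z \<le> 1 \<Longrightarrow> H z = G z"
  shows "coord_homogeneous j m (coord_coeff j m H)"
  unfolding coord_homogeneous_def
proof (intro allI impI)
  fix z :: "complex ^ 'a" and w :: complex assume z: "norm z \<le> 1" and w: "norm w \<le> 1"
  have coeff: "coord_coeff j m H v = (deriv ^^ m) (\<lambda>u. G (coord_mult j u v)) 0 / fact m" if "norm v \<le> 1" for v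
    using that unfolding coord_coeff_def circle_integral_Cauchy[OF sep_holomorphic_coord_mult[OF G that], symmetric]
    by (intro Bochner_Integration.integral_cong) (auto simp: H norm_coord_mult_eq)
  have "norm (coord_mult j w z) \<le> 1"
    using norm_coord_mult_le[OF w, of j z] z by simp
  moreover have "w * u \<in> ball 0 1" if "u \<in> ball 0 1" for u :: complex
    using that w mult_left_le_one_le[of "norm u" "norm w"] by (simp add: norm_mult)
  then have "(deriv ^^ m) (\<lambda>u. G (coord_mult j (w * u) z)) 0 = w ^ m * (deriv ^^ m) (\<lambda>u. G (coord_mult j u z)) (w * 0)"
    by (intro higher_deriv_compose_linear[OF sep_holomorphic_coord_mult(2)[OF G z], of "ball 0 1"]) auto
  ultimately show "coord_coeff j m H (coord_mult j w z) = w ^ m * coord_coeff j m H z"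
    using z by (simp add: coeff coord_mult_mult mult.commute)
qed

lemma coord_coeff_measurable:
  assumes [measurable]: "G \<in> borel_measurable borel"
  shows "coord_coeff j m G \<in> borel_measurable borel"
  unfolding coord_coeff_def[abs_def]
  by (intro unit_interval.borel_measurable_lebesgue_integral) measurable

lemma (in prob_space) norm_expectation_le:
  fixes f :: "'a \<Rightarrow> 'b :: {banach, second_countable_topology}"
  assumes "\<And>x. x \<in> space M \<Longrightarrow> norm (f x) \<le> B" "0 \<le> B"
  shows "norm (expectation f) \<le> B"
proof (cases "integrable M f")
  case True
  have "norm (expectation f) \<le> expectation (\<lambda>x. norm (f x))"
    by (rule integral_norm_bound)
  also have "\<dots> \<le> expectation (\<lambda>x. B)"
    using True assms by (intro integral_mono) auto
  finally show ?thesis by (simp add: prob_space)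
qed (use assms in \<open>simp add: not_integrable_integral_eq\<close>)

lemma coord_coeff_bounded_borel:
  assumes "bounded_borel G"
  shows "bounded_borel (coord_coeff j m G)"
proof -
  obtain B where G: "G \<in> borel_measurable borel" and B: "\<And>z. norm (G z) \<le> B" "B \<ge> 0"
    using assms bounded_borelE by blast
  have "norm (coord_coeff j m G z) \<le> B" for z
    unfolding coord_coeff_def using B
    by (intro unit_interval.norm_expectation_le) (auto simp: norm_mult norm_power)
  then show ?thesis
    unfolding bounded_borel_def using coord_coeff_measurable[OF G] by (auto simp: bounded_iff)
qed

lemma integrable_bounded_borel_pair:
  fixes f :: "'a \<times> 'b \<Rightarrow> 'c :: {banach, second_countable_topology}"
  assumes "prob_space M" "prob_space N" "f \<in> borel_measurable (M \<Otimes>\<^sub>M N)"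
    "\<And>x. x \<in> space M \<times> space N \<Longrightarrow> norm (f x) \<le> B"
  shows "integrable (M \<Otimes>\<^sub>M N) f"
proof -
  interpret pair_prob_space M N
    using assms by (simp add: pair_prob_space_def pair_sigma_finite_def prob_space_imp_sigma_finite)
  show ?thesis
    using assms(3,4) by (intro P.integrable_const_bound[where B = B]) (auto intro!: AE_I2 simp: space_pair_measure)
qed

text \<open>Fubini's theorem on the unit square, since the actions on two coordinates
  commute.\<close>

lemma coord_coeff_commute:
  assumes "bounded_borel G"
  shows "coord_coeff i m (coord_coeff j k G) z = coord_coeff j k (coord_coeff i m G) z"
proof -
  obtain B where [measurable]: "G \<in> borel_measurable borel" and B: "\<And>z. norm (G z) \<le> B" "B \<ge> 0"
    using assms bounded_borelE by blast
  interpret pair_prob_space unit_interval unit_interval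
    by standard
  let ?f = "\<lambda>s t. cnj (circ s) ^ m * (cnj (circ t) ^ k * G (coord_mult j (circ t) (coord_mult i (circ s) z)))"
  have "integrable (unit_interval \<Otimes>\<^sub>M unit_interval) (\<lambda>x. ?f (fst x) (snd x))"
    using B by (intro integrable_bounded_borel_pair[where B = B] unit_interval.prob_space_axioms)
      (measurable, auto simp: norm_mult norm_power)
  then have "(\<integral>t. (\<integral>s. ?f s t \<partial>unit_interval) \<partial>unit_interval) = (\<integral>s. (\<integral>t. ?f s t \<partial>unit_interval) \<partial>unit_interval)"
    by (intro Fubini_integral) (simp add: case_prod_unfold)
  also have "(\<lambda>s. \<integral>t. ?f s t \<partial>unit_interval) = (\<lambda>s. cnj (circ s) ^ m * coord_coeff j k G (coord_mult i (circ s) z))"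
    by (simp add: coord_coeff_def)
  also have "(\<lambda>t. \<integral>s. ?f s t \<partial>unit_interval) = (\<lambda>t. cnj (circ t) ^ k * coord_coeff i m G (coord_mult j (circ t) z))"
    unfolding coord_coeff_def integral_mult_right_zero[symmetric] coord_mult_commute[of j]
    by (simp only: mult.left_commute)
  finally show ?thesis
    by (simp only: coord_coeff_def[of i m "coord_coeff j k G"] coord_coeff_def[of j k "coord_coeff i m G"])
qed

lemma coord_coeff_preserves_homogeneous:
  assumes "coord_homogeneous i m G"
  shows "coord_homogeneous i m (coord_coeff j k G)"
  unfolding coord_homogeneous_def
proof (intro allI impI)
  fix z :: "complex ^ 'a" and w :: complex assume z: "norm z \<le> 1" and w: "norm w \<le> 1"
  have "coord_coeff j k G (coord_mult i w z) = (\<integral>t. w ^ m * (cnj (circ t) ^ k * G (coord_mult j (circ t) z)) \<partial>unit_interval)"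
    unfolding coord_coeff_def coord_mult_commute[of j _ i]
    using z w by (simp add: coord_homogeneousD[OF assms] norm_coord_mult_eq mult_ac)
  then show "coord_coeff j k G (coord_mult i w z) = w ^ m * coord_coeff j k G z"
    by (simp add: coord_coeff_def)
qed

text \<open>Cauchy's formula is available for \<open>G\<close> but not for its averages. Commuting
  the averages transfers homogeneity from the coefficient of \<open>G\<close> to that of
  \<open>coord_coeff j k G\<close>, which keeps the induction over coordinates going.\<close>

lemma coord_coeff_preserves_homogeneous_coeff:
  assumes "bounded_borel G" "coord_homogeneous i m (coord_coeff i m G)"
  shows "coord_homogeneous i m (coord_coeff i m (coord_coeff j k G))"
proof -
  have "coord_coeff i m (coord_coeff j k G) = coord_coeff j k (coord_coeff i m G)"
    using coord_coeff_commute[OF assms(1)] by blast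
  then show ?thesis
    using coord_coeff_preserves_homogeneous[OF assms(2)] by simp
qed

section \<open>Coordinate averages under the integral over the sphere\<close>

lemma (in prob_space) expectation_constant:
  fixes c :: "'b :: {banach, second_countable_topology}"
  shows "integral\<^sup>L M (\<lambda>_. c) = c"
  by (simp add: prob_space)

text \<open>The left side is unchanged by rotating coordinate \<open>j\<close>, hence equals its
  mean over all rotations. Under a rotation the monomials acquire powers of \<open>circ t\<close> as
  factors, and Fubini's theorem moves the mean onto \<open>G\<close>.\<close>

lemma sphere_integral_circle_mean:
  fixes G :: "complex ^ 'n \<Rightarrow> complex"
  assumes "bounded_borel G"
  shows "(\<integral>z. vec_power z \<alpha> * cnj (vec_power z \<beta>) * G z \<partial>sphere_measure) =
    (\<integral>z. vec_power z \<alpha> * cnj (vec_power z \<beta>) *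
      (\<integral>t. circ t ^ \<alpha> j * cnj (circ t) ^ \<beta> j * G (coord_mult j (circ t) z) \<partial>unit_interval) \<partial>sphere_measure)" (is "?L = _")
proof -
  obtain B where [measurable]: "G \<in> borel_measurable borel" and B: "\<And>z. norm (G z) \<le> B" "B \<ge> 0"
    using assms bounded_borelE by blast
  interpret pair_prob_space "sphere_measure :: (complex ^ 'n) measure" unit_interval
    by standard
  let ?f = "\<lambda>z t. vec_power z \<alpha> * cnj (vec_power z \<beta>) * (circ t ^ \<alpha> j * cnj (circ t) ^ \<beta> j * G (coord_mult j (circ t) z))"
  have B': "norm (?f z t) \<le> B" if "norm z = 1" for z t
  proof -
    have "norm (?f z t) = (norm (vec_power z \<alpha>) * norm (vec_power z \<beta>)) * norm (G (coord_mult j (circ t) z))"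
      by (simp add: norm_mult norm_power)
    also have "\<dots> \<le> 1 * B"
      using B norm_vec_power_le[of z] that by (intro mult_mono mult_le_one) auto
    finally show ?thesis by simp
  qed
  have "(\<integral>z. ?f z t \<partial>sphere_measure) = ?L" for t
  proof -
    have v: "vec_power (coord_mult j (circ t) z) \<alpha> * cnj (vec_power (coord_mult j (circ t) z) \<beta>) =
        (circ t ^ \<alpha> j * cnj (circ t) ^ \<beta> j) * (vec_power z \<alpha> * cnj (vec_power z \<beta>))" for z
      by (simp only: vec_power_coord_mult complex_cnj_mult complex_cnj_power mult_ac)
    have "(\<integral>z. vec_power (coord_mult j (circ t) z) \<alpha> * cnj (vec_power (coord_mult j (circ t) z) \<beta>) * G (coord_mult j (circ t) z) \<partial>sphere_measure) = ?L"
      by (rule integral_sphere_measure_orthogonal[OF orthogonal_transformation_coord_mult, of _ "\<lambda>z. vec_power z \<alpha> * cnj (vec_power z \<beta>) * G z"]) (simp, measurable)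
    then show ?thesis
      unfolding v by (simp only: mult_ac)
  qed
  then have "?L = (\<integral>t. (\<integral>z. ?f z t \<partial>sphere_measure) \<partial>unit_interval)"
    by (simp only: unit_interval.expectation_constant)
  also have "integrable (sphere_measure \<Otimes>\<^sub>M unit_interval) (\<lambda>x. ?f (fst x) (snd x))"
    using B' by (intro integrable_bounded_borel_pair[where B = B] unit_interval.prob_space_axioms sphere_measure.prob_space_axioms)
      (measurable, auto)
  then have "(\<integral>t. (\<integral>z. ?f z t \<partial>sphere_measure) \<partial>unit_interval) = (\<integral>z. (\<integral>t. ?f z t \<partial>unit_interval) \<partial>sphere_measure)"
    by (intro Fubini_integral) (simp add: case_prod_unfold)
  finally show ?thesis
    by simp
qed

lemma circ_power_mult_cnj: "circ t ^ k * cnj (circ t) ^ k = 1"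
proof -
  have "circ t * cnj (circ t) = 1"
    by (simp only: complex_norm_square[symmetric]) simp
  then show ?thesis
    by (simp only: power_mult_distrib[symmetric] power_one)
qed

lemma sphere_integral_coord_coeff:
  fixes G :: "complex ^ 'n \<Rightarrow> complex"
  assumes "bounded_borel G" "\<beta> j = \<alpha> j + m"
  shows "(\<integral>z. vec_power z \<alpha> * cnj (vec_power z \<beta>) * coord_coeff j m G z \<partial>sphere_measure) =
         (\<integral>z. vec_power z \<alpha> * cnj (vec_power z \<beta>) * G z \<partial>sphere_measure)"
proof -
  have "circ t ^ \<alpha> j * cnj (circ t) ^ \<beta> j = cnj (circ t) ^ m" for t
    by (simp only: assms(2) power_add mult.assoc[symmetric] circ_power_mult_cnj mult_1)
  then show ?thesis
    by (subst sphere_integral_circle_mean[OF assms(1), of \<alpha> \<beta> j]) (simp only: coord_coeff_def)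
qed

text \<open>Applies \<open>coord_coeff\<close> coordinate by coordinate. The clause on homogeneity
  inherited from \<open>G\<close> protects the coordinates already treated in the induction. One
  \<open>H\<close> serves all \<alpha>, which is why the constant obtained from it below depends on
  \<gamma> only.\<close>

lemma bounded_borel_homogeneous_projection:
  fixes G :: "complex ^ 'n \<Rightarrow> complex" and \<gamma> :: "'n \<Rightarrow> nat"
  assumes "finite J" "bounded_borel G" "\<And>j. j \<in> J \<Longrightarrow> coord_homogeneous j (\<gamma> j) (coord_coeff j (\<gamma> j) G)"
  shows "\<exists>H. bounded_borel H \<and> (\<forall>j\<in>J. coord_homogeneous j (\<gamma> j) H) \<and>
    (\<forall>j. coord_homogeneous j (\<gamma> j) G \<longrightarrow> coord_homogeneous j (\<gamma> j) H) \<and>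
    (\<forall>\<alpha>. (\<integral>z. vec_power z \<alpha> * cnj (vec_power z (\<lambda>i. \<alpha> i + \<gamma> i)) * H z \<partial>sphere_measure) =
          (\<integral>z. vec_power z \<alpha> * cnj (vec_power z (\<lambda>i. \<alpha> i + \<gamma> i)) * G z \<partial>sphere_measure))"
  using assms
proof (induction J arbitrary: G rule: finite_induct)
  case empty
  then show ?case by auto
next
  case (insert j J)
  define G' where "G' = coord_coeff j (\<gamma> j) G"
  have "bounded_borel G'"
    unfolding G'_def using insert.prems by (intro coord_coeff_bounded_borel)
  moreover have "coord_homogeneous i (\<gamma> i) (coord_coeff i (\<gamma> i) G')" if "i \<in> J" for i
    unfolding G'_def using insert.prems that by (intro coord_coeff_preserves_homogeneous_coeff) auto
  ultimately have "\<exists>H. bounded_borel H \<and> (\<forall>j\<in>J. coord_homogeneous j (\<gamma> j) H) \<and>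
    (\<forall>j. coord_homogeneous j (\<gamma> j) G' \<longrightarrow> coord_homogeneous j (\<gamma> j) H) \<and>
    (\<forall>\<alpha>. (\<integral>z. vec_power z \<alpha> * cnj (vec_power z (\<lambda>i. \<alpha> i + \<gamma> i)) * H z \<partial>sphere_measure) =
          (\<integral>z. vec_power z \<alpha> * cnj (vec_power z (\<lambda>i. \<alpha> i + \<gamma> i)) * G' z \<partial>sphere_measure))"
    by (rule insert.IH)
  then obtain H where H: "bounded_borel H" "\<forall>j\<in>J. coord_homogeneous j (\<gamma> j) H"
    "\<forall>j. coord_homogeneous j (\<gamma> j) G' \<longrightarrow> coord_homogeneous j (\<gamma> j) H"
    "\<forall>\<alpha>. (\<integral>z. vec_power z \<alpha> * cnj (vec_power z (\<lambda>i. \<alpha> i + \<gamma> i)) * H z \<partial>sphere_measure) =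
          (\<integral>z. vec_power z \<alpha> * cnj (vec_power z (\<lambda>i. \<alpha> i + \<gamma> i)) * G' z \<partial>sphere_measure)"
    by (elim exE conjE)
  have "coord_homogeneous j (\<gamma> j) H"
    using insert.prems by (intro H(3)[rule_format]) (auto simp: G'_def)
  moreover have "coord_homogeneous i (\<gamma> i) H" if "coord_homogeneous i (\<gamma> i) G" for i
    using that by (intro H(3)[rule_format]) (simp add: G'_def coord_coeff_preserves_homogeneous)
  moreover have "(\<integral>z. vec_power z \<alpha> * cnj (vec_power z (\<lambda>i. \<alpha> i + \<gamma> i)) * G' z \<partial>sphere_measure) =
      (\<integral>z. vec_power z \<alpha> * cnj (vec_power z (\<lambda>i. \<alpha> i + \<gamma> i)) * G z \<partial>sphere_measure)" for \<alpha>
    unfolding G'_def by (rule sphere_integral_coord_coeff[OF insert.prems(1)]) simp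
  ultimately show ?case
    using H(1,2,4) by (intro exI[of _ H]) simp
qed

text \<open>The value of \<open>H\<close> at the coordinatewise product of \<open>v\<close> and
  \<open>z\<close> is computed twice, with either point supplying the factors: v^\<gamma> H(z) =
  z^\<gamma> H(v). A fixed \<open>v\<close> without zero coordinates then determines
  \<open>H\<close>.\<close>

lemma multi_homogeneous_imp_monomial:
  fixes H :: "complex ^ 'n \<Rightarrow> complex" and \<gamma> :: "'n \<Rightarrow> nat"
  assumes H: "\<And>j. coord_homogeneous j (\<gamma> j) H"
  shows "\<exists>C. \<forall>z. norm z \<le> 1 \<longrightarrow> H z = C * vec_power z \<gamma>"
proof -
  define mult where "mult J w z = (\<chi> i. if i \<in> J then w $ i * z $ i else z $ i)" for J and w z :: "complex ^ 'n"
  have mult: "norm (mult J w z) \<le> 1 \<and> H (mult J w z) = (\<Prod>j\<in>J. (w $ j) ^ \<gamma> j) * H z"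
    if "finite J" "norm z \<le> 1" "\<And>j. norm (w $ j) \<le> 1" for J and w z :: "complex ^ 'n"
    using that
  proof (induction J rule: finite_induct)
    case empty
    moreover have "mult {} w z = z" by (simp add: mult_def vec_eq_iff)
    ultimately show ?case by simp
  next
    case (insert j J)
    have "mult (insert j J) w z = coord_mult j (w $ j) (mult J w z)"
      using insert.hyps by (auto simp: mult_def vec_eq_iff)
    moreover have "norm (coord_mult j (w $ j) (mult J w z)) \<le> 1"
      using norm_coord_mult_le[of "w $ j" j "mult J w z"] insert by (auto intro: order_trans)
    ultimately show ?case
      using insert by (simp add: coord_homogeneousD[OF H])
  qed
  \<comment> \<open>Nonzero, and small enough that the vector \<open>v\<close> of equal coordinates
    \<open>c\<close> stays in the closed ball: its norm is at most the sum of its coordinates, which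
    is 1.\<close>
  define c where "c = complex_of_real (1 / real CARD('n))"
  define v where "v = ((\<chi> i. c) :: complex ^ 'n)"
  have "c \<noteq> 0" by (simp add: c_def)
  have c: "norm c \<le> 1" by (simp add: c_def norm_divide divide_le_eq Suc_leI)
  have "norm v \<le> (\<Sum>i\<in>(UNIV :: 'n set). norm (v $ i))"
    unfolding norm_vec_def by (rule L2_set_le_sum) simp
  then have v: "norm v \<le> 1"
    by (simp add: v_def c_def norm_divide)
  have "H z = (H v / (\<Prod>j\<in>UNIV. c ^ \<gamma> j)) * vec_power z \<gamma>" if z: "norm z \<le> 1" for z
  proof -
    have zj: "norm (z $ j) \<le> 1" for j
      using z Finite_Cartesian_Product.norm_nth_le[of z j] by linarith
    have "mult UNIV z v = mult UNIV v z"
      by (simp add: mult_def v_def vec_eq_iff mult.commute)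
    then have "(\<Prod>j\<in>UNIV. c ^ \<gamma> j) * H z = vec_power z \<gamma> * H v"
      using mult[of UNIV v z] mult[of UNIV z v] v z zj c by (simp add: v_def[symmetric] vec_power_def) (simp add: v_def)
    then show ?thesis
      using \<open>c \<noteq> 0\<close> by (simp add: field_simps)
  qed
  then show ?thesis by blast
qed

text \<open>The extension of \<open>g\<close> to the closed ball is continued by 0 to a total
  bounded Borel function. Holomorphy enters the computation of moments only through the last two
  conclusions: homogeneous coefficients and the absence of negative frequencies.\<close>

lemma sphere_algebra_bounded_borel:
  fixes g :: "complex ^ 'n \<Rightarrow> complex"
  assumes "g \<in> sphere_algebra"
  obtains G where "bounded_borel G" "\<And>z. norm z = 1 \<Longrightarrow> g z = G z"
    "\<And>j m. coord_homogeneous j m (coord_coeff j m G)"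
    "\<And>j m z. 0 < m \<Longrightarrow> norm z \<le> 1 \<Longrightarrow> (\<integral>t. circ t ^ m * G (coord_mult j (circ t) z) \<partial>unit_interval) = 0"
proof -
  obtain F where F: "continuous_on (cball 0 1) F" "sep_holomorphic_on_ball F" "\<And>z. norm z = 1 \<Longrightarrow> g z = F z"
    using assms unfolding sphere_algebra_def by auto
  define G where "G z = (if z \<in> cball 0 1 then F z else 0)" for z
  show ?thesis
  proof
    have "bounded (F ` cball 0 1)"
      using F(1) by (intro compact_imp_bounded compact_continuous_image) auto
    moreover have "range G \<subseteq> insert 0 (F ` cball 0 1)"
      by (auto simp: G_def)
    ultimately have "bounded (range G)"
      using bounded_insert bounded_subset by blast
    moreover have "G \<in> borel_measurable borel"
      unfolding G_def[abs_def] using F(1) by (intro borel_measurable_continuous_on_if) auto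
    ultimately show "bounded_borel G"
      by (simp add: bounded_borel_def)
    show "g z = G z" if "norm z = 1" for z
      using F(3)[OF that] that by (simp add: G_def)
    show "coord_homogeneous j m (coord_coeff j m G)" for j m
      by (rule coord_coeff_homogeneous[OF F(1,2)]) (simp add: G_def)
    show "(\<integral>t. circ t ^ m * G (coord_mult j (circ t) z) \<partial>unit_interval) = 0" if "0 < m" "norm z \<le> 1" for j m z
      using circle_integral_Cauchy_0[OF sep_holomorphic_coord_mult[OF F(1,2) that(2)] that(1), of j] that
      by (simp add: G_def norm_coord_mult_eq)
  qed
qed

text \<open>After projection to multi-degree \<gamma> the integrand is \<open>C\<close> times the
  squared modulus of the monomial of index \<alpha> + \<gamma>, whose integral is
  \<open>multi_coeff\<close>. That \<open>C\<close> does not depend on \<alpha> is the content of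
  condition (b).\<close>

lemma sphere_algebra_moments:
  fixes g :: "complex ^ 'n \<Rightarrow> complex"
  assumes "g \<in> sphere_algebra"
  obtains C where "\<And>\<alpha>. (\<integral>z. vec_power z \<alpha> * cnj (vec_power z (\<lambda>i. \<alpha> i + \<gamma> i)) * g z \<partial>sphere_measure) =
    C * of_real (multi_coeff (\<lambda>i. \<alpha> i + \<gamma> i))"
proof -
  obtain G where G: "bounded_borel G" "\<And>z. norm z = 1 \<Longrightarrow> g z = G z"
    "\<And>j m. coord_homogeneous j m (coord_coeff j m G)"
    using assms by (rule sphere_algebra_bounded_borel) blast
  obtain H where H: "\<And>j. coord_homogeneous j (\<gamma> j) H"
    "\<And>\<alpha>. (\<integral>z. vec_power z \<alpha> * cnj (vec_power z (\<lambda>i. \<alpha> i + \<gamma> i)) * H z \<partial>sphere_measure) =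
          (\<integral>z. vec_power z \<alpha> * cnj (vec_power z (\<lambda>i. \<alpha> i + \<gamma> i)) * G z \<partial>sphere_measure)"
    using bounded_borel_homogeneous_projection[OF finite G(1), of UNIV \<gamma>] G(3) by auto
  obtain C where C: "\<And>z. norm z \<le> 1 \<Longrightarrow> H z = C * vec_power z \<gamma>"
    using multi_homogeneous_imp_monomial[OF H(1)] by blast
  have "(\<integral>z. vec_power z \<alpha> * cnj (vec_power z (\<lambda>i. \<alpha> i + \<gamma> i)) * g z \<partial>sphere_measure) =
    C * of_real (multi_coeff (\<lambda>i. \<alpha> i + \<gamma> i))" for \<alpha>
  proof -
    have "(\<integral>z. vec_power z \<alpha> * cnj (vec_power z (\<lambda>i. \<alpha> i + \<gamma> i)) * g z \<partial>sphere_measure) =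
        (\<integral>z. vec_power z \<alpha> * cnj (vec_power z (\<lambda>i. \<alpha> i + \<gamma> i)) * H z \<partial>sphere_measure)"
      unfolding H(2) using G(2) by (intro Bochner_Integration.integral_cong) auto
    also have "\<dots> = (\<integral>z. C * (vec_power z (\<lambda>i. \<alpha> i + \<gamma> i) * cnj (vec_power z (\<lambda>i. \<alpha> i + \<gamma> i))) \<partial>sphere_measure)"
      using C by (intro Bochner_Integration.integral_cong) (auto simp: vec_power_add)
    finally show ?thesis
      by (simp add: sphere_moment_eq[symmetric] sphere_moment_def)
  qed
  then show ?thesis by (rule that)
qed

text \<open>Averaging over coordinate \<open>j\<close> leaves the positive power \<open>m\<close> of
  \<open>circ t\<close> against \<open>G\<close>, and this mean vanishes by Cauchy's
  theorem.\<close>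

lemma sphere_algebra_moments_0:
  fixes g :: "complex ^ 'n \<Rightarrow> complex"
  assumes "g \<in> sphere_algebra" "\<beta> j < \<alpha> j"
  shows "(\<integral>z. vec_power z \<alpha> * cnj (vec_power z \<beta>) * g z \<partial>sphere_measure) = 0"
proof -
  obtain G where G: "bounded_borel G" "\<And>z. norm z = 1 \<Longrightarrow> g z = G z"
    "\<And>j m z. 0 < m \<Longrightarrow> norm z \<le> 1 \<Longrightarrow> (\<integral>t. circ t ^ m * G (coord_mult j (circ t) z) \<partial>unit_interval) = 0"
    using assms(1) by (rule sphere_algebra_bounded_borel) blast
  define m where "m = \<alpha> j - \<beta> j"
  have m: "m > 0" "\<alpha> j = m + \<beta> j"
    using assms(2) by (auto simp: m_def)
  have *: "circ t ^ \<alpha> j * cnj (circ t) ^ \<beta> j = circ t ^ m" for t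
    unfolding m(2) power_add mult.assoc[of "circ t ^ m"] circ_power_mult_cnj by (rule mult_1_right)
  have "(\<integral>z. vec_power z \<alpha> * cnj (vec_power z \<beta>) * g z \<partial>sphere_measure) =
        (\<integral>z. vec_power z \<alpha> * cnj (vec_power z \<beta>) * G z \<partial>sphere_measure)"
    using G(2) by (intro Bochner_Integration.integral_cong) auto
  also have "\<dots> = (\<integral>z. vec_power z \<alpha> * cnj (vec_power z \<beta>) *
      (\<integral>t. circ t ^ m * G (coord_mult j (circ t) z) \<partial>unit_interval) \<partial>sphere_measure)"
    by (subst sphere_integral_circle_mean[OF G(1), of \<alpha> \<beta> j]) (simp only: *)
  also have "\<dots> = (\<integral>z. 0 \<partial>(sphere_measure :: (complex ^ 'n) measure))"
    using G(3)[OF m(1)] by (intro Bochner_Integration.integral_cong) auto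
  finally show ?thesis by simp
qed

subsection \<open>A zonal approximate identity\<close>

text \<open>For distinct points \<open>U\<close> is the reflection in the hyperplane orthogonal to
  \<open>x - y\<close>.\<close>

lemma orthogonal_transformation_exists_inner:
  fixes x y :: "'a :: euclidean_space"
  assumes "norm x = norm y"
  obtains U where "orthogonal_transformation U" "U x = y"
proof (cases "x = y")
  case True
  then show ?thesis using that[of "\<lambda>v. v"] by (simp add: orthogonal_transformation_id)
next
  case False
  define w where "w = x - y"
  define U where "U v = v - (2 * (v \<bullet> w) / (w \<bullet> w)) *\<^sub>R w" for v
  have w: "w \<bullet> w \<noteq> 0" using False by (simp add: w_def)
  have "x \<bullet> x = y \<bullet> y" using assms by (simp add: norm_eq)
  then have "2 * (x \<bullet> w) = w \<bullet> w"
    by (simp add: w_def inner_diff_left inner_diff_right inner_commute)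
  then have "U x = y" using w by (simp add: U_def) (simp add: w_def)
  moreover have "linear U"
    by (rule linearI) (simp_all add: U_def inner_add_left algebra_simps add_divide_distrib)
  moreover have "U v \<bullet> U v = v \<bullet> v" for v
    using w by (simp add: U_def inner_diff_left inner_diff_right inner_commute field_simps)
  then have "norm (U v) = norm v" for v
    by (simp add: norm_eq)
  ultimately show ?thesis
    using that[of U] by (simp add: orthogonal_transformation)
qed

section \<open>The zonal kernel: positivity, normalization and concentration\<close>

lemma one_plus_inner_bounds:
  assumes "norm x = 1" "norm y = 1"
  shows "0 \<le> 1 + x \<bullet> y" "1 + x \<bullet> y \<le> 2"
  using Cauchy_Schwarz_ineq2[of x y] assms by auto

lemma norm_axis_complex: "norm (axis i 1 :: complex ^ 'n) = 1"
proof -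
  have "(norm (axis i 1 :: complex ^ 'n))\<^sup>2 = (\<Sum>j\<in>UNIV. if j = i then 1 else 0)"
    unfolding norm_vec_complex_sq by (intro sum.cong) (auto simp: axis_def)
  then show ?thesis by simp
qed

text \<open>By rotation invariance the value is the same for every unit vector in place of
  \<open>axis undefined 1\<close>; a fixed one makes the kernel visibly symmetric.\<close>

definition kernel_mass :: "'n :: finite itself \<Rightarrow> nat \<Rightarrow> real" where
  "kernel_mass _ m = (\<integral>y. (1 + (axis undefined 1 :: complex ^ 'n) \<bullet> y) ^ m \<partial>sphere_measure)"

definition zonal_kernel :: "nat \<Rightarrow> complex ^ 'n \<Rightarrow> complex ^ 'n \<Rightarrow> real" where
  "zonal_kernel m x y = (1 + x \<bullet> y) ^ m / kernel_mass TYPE('n) m"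

lemma kernel_mass_eq:
  fixes x :: "complex ^ 'n"
  assumes "norm x = 1"
  shows "(\<integral>y. (1 + x \<bullet> y) ^ m \<partial>sphere_measure) = kernel_mass TYPE('n) m"
proof -
  let ?e = "axis undefined 1 :: complex ^ 'n"
  obtain U where U: "orthogonal_transformation U" "U ?e = x"
    using orthogonal_transformation_exists_inner[of ?e x] assms by (auto simp: norm_axis_complex)
  have "kernel_mass TYPE('n) m = (\<integral>y. (1 + x \<bullet> U y) ^ m \<partial>sphere_measure)"
    using U by (auto simp: kernel_mass_def orthogonal_transformation_def)
  also have "\<dots> = (\<integral>y. (1 + x \<bullet> y) ^ m \<partial>sphere_measure)"
    by (rule integral_sphere_measure_orthogonal[OF U(1)]) measurable
  finally show ?thesis by simp
qed

lemma integrable_one_plus_inner_power: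
  "integrable sphere_measure (\<lambda>y :: complex ^ 'n. (1 + x \<bullet> y) ^ m)"
  by (intro integrable_sphere_measure_continuous_on continuous_intros)

text \<open>The sphere measure of a cap is a multiple of the volume of the cone over it, and this
  cone contains a ball around half of \<open>e\<close>.\<close>

lemma sphere_cap_measure_pos:
  fixes e :: "complex ^ 'n"
  assumes e: "norm e = 1" and "b < 1"
  shows "0 < measure sphere_measure {y \<in> sphere 0 1. b < e \<bullet> y}"
proof -
  define A where "A = {y :: complex ^ 'n. norm y = 1 \<and> b < e \<bullet> y}"
  have A_eq: "A = {y \<in> sphere 0 1. b < e \<bullet> y}"
    by (auto simp: A_def)
  \<comment> \<open>Points of the ball whose direction lies in the cap, with the division by the
    norm cleared so that openness is evident.\<close>
  define V where "V = ball 0 1 \<inter> - {0} \<inter> {z. b * norm z < z \<bullet> e}"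
  have [measurable]: "A \<in> sets borel"
    unfolding A_def by measurable
  have "open V"
    unfolding V_def by (intro open_Int open_Collect_less continuous_intros) auto
  moreover have "(1/2) *\<^sub>R e \<in> V"
    using assms by (auto simp: V_def dot_square_norm)
  ultimately obtain r where r: "r > 0" "ball ((1/2) *\<^sub>R e) r \<subseteq> V"
    unfolding open_contains_ball by blast
  have "V \<subseteq> {z \<in> ball 0 1. sgn z \<in> A}"
  proof
    fix z assume "z \<in> V"
    then have z: "norm z < 1" "z \<noteq> 0" "b * norm z < z \<bullet> e"
      by (auto simp: V_def)
    have "b < (z \<bullet> e) / norm z"
      using z by (simp add: pos_less_divide_eq)
    then have "b < e \<bullet> sgn z"
      by (simp add: sgn_div_norm inner_commute divide_inverse mult.commute)
    then show "z \<in> {z \<in> ball 0 1. sgn z \<in> A}"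
      using z by (simp add: A_def norm_sgn)
  qed
  then have "ball ((1/2) *\<^sub>R e) r \<subseteq> {z \<in> ball 0 1. sgn z \<in> A}"
    using r(2) by (rule order_trans[rotated])
  moreover have "{z \<in> ball 0 1. sgn z \<in> A} = ball 0 1 \<inter> (sgn -` A \<inter> space borel)"
    by auto
  then have "{z \<in> ball 0 1. sgn z \<in> A} \<in> sets lborel"
    using measurable_sets[OF borel_measurable_sgn_vec \<open>A \<in> sets borel\<close>] by (simp del: ball_simps)
  ultimately have "emeasure lborel (ball ((1/2) *\<^sub>R e) r) \<le> emeasure lborel {z \<in> ball 0 1. sgn z \<in> A}"
    by (intro emeasure_mono)
  moreover have "emeasure lborel (ball ((1/2) *\<^sub>R e) r) > 0"
    using r(1) by (simp add: emeasure_ball unit_ball_vol_pos)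
  ultimately have "emeasure lborel {z \<in> ball 0 1. sgn z \<in> A} \<noteq> 0"
    by auto
  then have "emeasure sphere_measure A \<noteq> 0"
    using emeasure_lborel_unit_ball[where 'a = "complex ^ 'n"]
    by (subst emeasure_sphere_measure) (auto simp: A_def[symmetric] ennreal_divide_eq_0_iff, simp add: A_def)
  then show ?thesis
    unfolding A_eq[symmetric] using sphere_measure.emeasure_eq_measure[of A] by (simp add: zero_less_measure_iff)
qed

text \<open>Markov's inequality: on the cap the integrand is at least \<open>b ^ m\<close>.\<close>

lemma kernel_mass_ge:
  fixes e :: "complex ^ 'n"
  assumes e: "norm e = 1" and "0 \<le> b"
  shows "b ^ m * measure sphere_measure {y \<in> sphere 0 1. b - 1 < e \<bullet> y} \<le> kernel_mass TYPE('n) m"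
proof -
  let ?A = "{y \<in> sphere 0 1. b - 1 < e \<bullet> y}"
  have A: "?A \<in> sets sphere_measure"
    by (auto simp: sets_sphere_measure sets_restrict_space_iff)
  have "b ^ m * measure sphere_measure ?A = (\<integral>y. b ^ m * indicator ?A y \<partial>sphere_measure)"
    using A sets.sets_into_space[OF A] by (simp add: Int_absorb2)
  also have "\<dots> \<le> (\<integral>y. (1 + e \<bullet> y) ^ m \<partial>sphere_measure)"
  proof (rule integral_mono)
    show "integrable sphere_measure (\<lambda>y. b ^ m * indicator ?A y)"
      using A by (intro integrable_mult_right sphere_measure.integrable_const_bound[where B = 1]) (auto simp: indicator_def)
    show "b ^ m * indicator ?A y \<le> (1 + e \<bullet> y) ^ m" if "y \<in> space sphere_measure" for y
      using that one_plus_inner_bounds[OF e, of y] \<open>0 \<le> b\<close> by (auto simp: indicator_def intro!: power_mono)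
  qed (rule integrable_one_plus_inner_power)
  finally show ?thesis by (simp add: kernel_mass_eq[OF e])
qed

lemma kernel_mass_pos: "0 < kernel_mass TYPE('n :: finite) m"
proof -
  let ?e = "axis undefined 1 :: complex ^ 'n"
  have "norm ?e = 1" by (simp add: norm_axis_complex)
  then show ?thesis
    using kernel_mass_ge[of ?e 1 m] sphere_cap_measure_pos[of ?e 0] by simp
qed

lemma zonal_kernel_nonneg:
  fixes x y :: "complex ^ 'n"
  shows "norm x = 1 \<Longrightarrow> norm y = 1 \<Longrightarrow> 0 \<le> zonal_kernel m x y"
  using one_plus_inner_bounds[of x y] kernel_mass_pos[where 'n = 'n, of m]
  by (simp add: zonal_kernel_def less_imp_le)

lemma zonal_kernel_le:
  fixes x y :: "complex ^ 'n"
  shows "norm x = 1 \<Longrightarrow> norm y = 1 \<Longrightarrow> zonal_kernel m x y \<le> 2 ^ m / kernel_mass TYPE('n) m"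
  using one_plus_inner_bounds[of x y] kernel_mass_pos[where 'n = 'n, of m]
  unfolding zonal_kernel_def by (intro divide_right_mono power_mono) auto

lemma zonal_kernel_commute: "zonal_kernel m x y = zonal_kernel m y x"
  by (simp add: zonal_kernel_def inner_commute)

lemma integral_zonal_kernel:
  fixes x :: "complex ^ 'n"
  shows "norm x = 1 \<Longrightarrow> (\<integral>y. zonal_kernel m x y \<partial>sphere_measure) = 1"
  using kernel_mass_pos[where 'n = 'n, of m] by (simp add: zonal_kernel_def kernel_mass_eq)

lemma integrable_zonal_kernel: "integrable sphere_measure (zonal_kernel m x)"
  unfolding zonal_kernel_def[abs_def] by (intro integrable_sphere_measure_continuous_on continuous_intros) (simp add: kernel_mass_pos less_imp_neq[symmetric])

lemma zonal_kernel_measurable [measurable]: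
  assumes [measurable]: "f \<in> borel_measurable M" "g \<in> borel_measurable M"
  shows "(\<lambda>x. zonal_kernel m (f x) (g x)) \<in> borel_measurable M"
  unfolding zonal_kernel_def by measurable

text \<open>At distance at least \<delta> the base \<open>1 + x \<bullet> y\<close> is at most some
  \<open>a < 2\<close>, while the mass is at least a fixed multiple of \<open>b ^ m\<close> for any
  \<open>b\<close> between \<open>a\<close> and 2. The quotient decays geometrically, uniformly in
  both points.\<close>

lemma zonal_kernel_concentration:
  assumes "0 < \<delta>" "0 < \<epsilon>"
  shows "\<forall>\<^sub>F m in sequentially. \<forall>x y :: complex ^ 'n. norm x = 1 \<longrightarrow> norm y = 1 \<longrightarrow> \<delta> \<le> dist x y \<longrightarrow> zonal_kernel m x y \<le> \<epsilon>"
proof -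
  \<comment> \<open>Capping the distance at 1 keeps \<open>a\<close> and \<open>b\<close> positive.
    The value of \<open>a\<close> comes from |x - y|^2 = 2 - 2 (x \<bullet> y) on the
    sphere.\<close>
  define \<eta> where "\<eta> = min \<delta> 1"
  have \<eta>: "0 < \<eta>" "\<eta> \<le> 1" "\<eta> \<le> \<delta>" using assms by (auto simp: \<eta>_def)
  have \<eta>2: "0 < \<eta>\<^sup>2" "\<eta>\<^sup>2 \<le> 1" using \<eta> by (auto simp: power_le_one)
  define a b where "a = 2 - \<eta>\<^sup>2 / 2" and "b = 2 - \<eta>\<^sup>2 / 4"
  have ab: "0 < a" "a < b" "0 < b" "b < 2" using \<eta>2 by (auto simp: a_def b_def)
  define e where "e = (axis undefined 1 :: complex ^ 'n)"
  have e: "norm e = 1" by (simp add: e_def norm_axis_complex)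
  define s where "s = measure sphere_measure {y \<in> sphere 0 1. b - 1 < e \<bullet> y}"
  have s: "s > 0" unfolding s_def using e ab by (intro sphere_cap_measure_pos) auto
  have le: "zonal_kernel m x y \<le> (a / b) ^ m / s" if xy: "norm x = 1" "norm y = 1" "\<delta> \<le> dist x y" for m and x y :: "complex ^ 'n"
  proof -
    have "\<eta>\<^sup>2 \<le> (dist x y)\<^sup>2"
      using \<eta> xy by (intro power_mono) auto
    also have "x \<bullet> x = 1" "y \<bullet> y = 1"
      using xy by (simp_all add: dot_square_norm)
    then have "(dist x y)\<^sup>2 = 2 - 2 * (x \<bullet> y)"
      by (simp add: dist_norm power2_norm_eq_inner inner_diff_left inner_diff_right inner_commute)
    finally have "1 + x \<bullet> y \<le> a" by (simp add: a_def)
    then have "(1 + x \<bullet> y) ^ m \<le> a ^ m"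
      using one_plus_inner_bounds[OF xy(1,2)] by (intro power_mono) auto
    moreover have "b ^ m * s \<le> kernel_mass TYPE('n) m"
      unfolding s_def using e ab by (intro kernel_mass_ge) auto
    ultimately have "zonal_kernel m x y \<le> a ^ m / (b ^ m * s)"
      unfolding zonal_kernel_def using ab s by (intro frac_le) auto
    then show ?thesis by (simp add: power_divide)
  qed
  have "(\<lambda>m. (a / b) ^ m / s) \<longlonglongrightarrow> 0 / s"
    using ab s by (intro tendsto_intros LIMSEQ_power_zero) auto
  then have "\<forall>\<^sub>F m in sequentially. (a / b) ^ m / s < \<epsilon>"
    using assms by (simp add: order_tendstoD)
  then show ?thesis
    by eventually_elim (intro allI impI, rule order_trans[OF le], assumption+, rule less_imp_le)
qed

definition zonal_mean :: "nat \<Rightarrow> (complex ^ 'n \<Rightarrow> complex) \<Rightarrow> complex ^ 'n \<Rightarrow> complex" where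
  "zonal_mean m f x = (\<integral>y. of_real (zonal_kernel m x y) * f y \<partial>sphere_measure)"

lemma integrable_zonal_kernel_mult:
  fixes f :: "complex ^ 'n \<Rightarrow> complex"
  assumes "integrable sphere_measure f" "norm x = 1"
  shows "integrable sphere_measure (\<lambda>y. of_real (zonal_kernel m x y) * f y)"
proof (rule Bochner_Integration.integrable_bound)
  show "integrable sphere_measure (\<lambda>y. (2 ^ m / kernel_mass TYPE('n) m) * norm (f y))"
    using assms by auto
  show "(\<lambda>y. of_real (zonal_kernel m x y) * f y) \<in> borel_measurable sphere_measure"
    using assms by measurable
  show "AE y in sphere_measure. norm (of_real (zonal_kernel m x y) * f y) \<le> norm ((2 ^ m / kernel_mass TYPE('n) m) * norm (f y))"
  proof (rule AE_I2)
    fix y :: "complex ^ 'n" assume "y \<in> space sphere_measure"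
    then have y: "norm y = 1" by simp
    have "norm (of_real (zonal_kernel m x y) * f y) = zonal_kernel m x y * norm (f y)"
      using zonal_kernel_nonneg[OF assms(2) y, of m] by (simp add: norm_mult)
    also have "\<dots> \<le> (2 ^ m / kernel_mass TYPE('n) m) * norm (f y)"
      using zonal_kernel_le[OF assms(2) y] by (rule mult_right_mono) simp
    finally show "norm (of_real (zonal_kernel m x y) * f y) \<le> norm ((2 ^ m / kernel_mass TYPE('n) m) * norm (f y))"
      using kernel_mass_pos[where 'n = 'n, of m] by simp
  qed
qed

lemma zonal_mean_uniform_approx:
  fixes g :: "complex ^ 'n \<Rightarrow> complex"
  assumes g: "continuous_on (sphere 0 1) g" and "0 < \<epsilon>"
  shows "\<exists>m. \<forall>x. norm x = 1 \<longrightarrow> norm (zonal_mean m g x - g x) \<le> \<epsilon>"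
proof -
  have "bounded (g ` sphere 0 1)"
    using g by (intro compact_imp_bounded compact_continuous_image) auto
  then obtain B where B: "B > 0" "\<And>z. norm z = 1 \<Longrightarrow> norm (g z) \<le> B"
    unfolding bounded_pos by (metis image_eqI mem_sphere_0)
  have "uniformly_continuous_on (sphere 0 1) g"
    using g by (intro compact_uniformly_continuous) auto
  then obtain \<delta> where \<delta>: "\<delta> > 0" "\<And>x y. norm x = 1 \<Longrightarrow> norm y = 1 \<Longrightarrow> dist x y < \<delta> \<Longrightarrow> dist (g x) (g y) < \<epsilon> / 2"
    unfolding uniformly_continuous_on_def using half_gt_zero[OF \<open>0 < \<epsilon>\<close>] by (metis mem_sphere_0)
  have "0 < \<epsilon> / (4 * B)" using \<open>0 < \<epsilon>\<close> B by simp
  then have "\<forall>\<^sub>F m in sequentially. \<forall>x y :: complex ^ 'n. norm x = 1 \<longrightarrow> norm y = 1 \<longrightarrow> \<delta> \<le> dist x y \<longrightarrow> zonal_kernel m x y \<le> \<epsilon> / (4 * B)"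
    by (rule zonal_kernel_concentration[OF \<delta>(1)])
  then obtain m where m: "\<And>x y :: complex ^ 'n. norm x = 1 \<Longrightarrow> norm y = 1 \<Longrightarrow> \<delta> \<le> dist x y \<Longrightarrow> zonal_kernel m x y \<le> \<epsilon> / (4 * B)"
    by (auto simp: eventually_sequentially)
  have ig: "integrable sphere_measure g"
    using g by (rule integrable_sphere_measure_continuous_on)
  have "norm (zonal_mean m g x - g x) \<le> \<epsilon>" if x: "norm x = 1" for x
  proof -
    have i1: "integrable sphere_measure (\<lambda>y. of_real (zonal_kernel m x y) * h y)" if "integrable sphere_measure h" for h :: "complex ^ 'n \<Rightarrow> complex"
      using that x by (rule integrable_zonal_kernel_mult)
    have "(\<integral>y. complex_of_real (zonal_kernel m x y) * g x \<partial>sphere_measure) = g x"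
      using integral_zonal_kernel[OF x, of m] by simp
    then have "zonal_mean m g x - g x = (\<integral>y. of_real (zonal_kernel m x y) * g y \<partial>sphere_measure) - (\<integral>y. of_real (zonal_kernel m x y) * g x \<partial>sphere_measure)"
      by (simp add: zonal_mean_def)
    also have "\<dots> = (\<integral>y. of_real (zonal_kernel m x y) * (g y - g x) \<partial>sphere_measure)"
      unfolding right_diff_distrib using ig by (intro Bochner_Integration.integral_diff[symmetric] i1) auto
    also have "norm \<dots> \<le> (\<integral>y. norm (of_real (zonal_kernel m x y) * (g y - g x)) \<partial>sphere_measure)"
      by (rule integral_norm_bound)
    \<comment> \<open>The first summand covers the points near \<open>x\<close>, by uniform
      continuity; the second covers the rest, where the kernel is at most
      \<open>\<epsilon> / (4 * B)\<close> and \<open>g\<close> varies by at most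
      \<open>2 * B\<close>.\<close>
    also have "\<dots> \<le> (\<integral>y. \<epsilon> / 2 * zonal_kernel m x y + \<epsilon> / 2 \<partial>sphere_measure)"
    proof (rule integral_mono)
      show "integrable sphere_measure (\<lambda>y. norm (of_real (zonal_kernel m x y) * (g y - g x)))"
        using ig by (intro integrable_norm i1) auto
      show "integrable sphere_measure (\<lambda>y. \<epsilon> / 2 * zonal_kernel m x y + \<epsilon> / 2)"
        using integrable_zonal_kernel[of m x] by auto
      fix y :: "complex ^ 'n" assume "y \<in> space sphere_measure"
      then have y: "norm y = 1" by simp
      have K: "0 \<le> zonal_kernel m x y" using x y by (rule zonal_kernel_nonneg)
      show "norm (of_real (zonal_kernel m x y) * (g y - g x)) \<le> \<epsilon> / 2 * zonal_kernel m x y + \<epsilon> / 2"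
      proof (cases "dist x y < \<delta>")
        case True
        then have "norm (g y - g x) \<le> \<epsilon> / 2"
          using \<delta>(2)[OF x y] by (simp add: dist_norm norm_minus_commute)
        then have "zonal_kernel m x y * norm (g y - g x) \<le> zonal_kernel m x y * (\<epsilon> / 2)"
          using K by (intro mult_left_mono)
        then show ?thesis using K \<open>0 < \<epsilon>\<close> by (simp add: norm_mult mult.commute)
      next
        case False
        have "norm (g y - g x) \<le> 2 * B"
          using B(2)[OF x] B(2)[OF y] norm_triangle_ineq4[of "g y" "g x"] by linarith
        then have "zonal_kernel m x y * norm (g y - g x) \<le> \<epsilon> / (4 * B) * (2 * B)"
          using m[OF x y] False K B \<open>0 < \<epsilon>\<close> by (intro mult_mono) auto
        also have "\<dots> = \<epsilon> / 2" using B by simp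
        finally have "zonal_kernel m x y * norm (g y - g x) \<le> \<epsilon> / 2" .
        moreover have "0 \<le> \<epsilon> / 2 * zonal_kernel m x y" using K \<open>0 < \<epsilon>\<close> by simp
        moreover have "norm (of_real (zonal_kernel m x y) * (g y - g x)) = zonal_kernel m x y * norm (g y - g x)"
          using K by (simp add: norm_mult)
        ultimately show ?thesis by linarith
      qed
    qed
    also have "\<dots> = \<epsilon>"
      using integrable_zonal_kernel[of m x] integral_zonal_kernel[OF x, of m] sphere_measure.prob_space[where 'n = 'n] by simp
    finally show ?thesis .
  qed
  then show ?thesis by blast
qed

section \<open>Zonal means as contractions of \<open>L\<^sup>p\<close>\<close>

lemma zonal_mean_measurable:
  fixes f :: "complex ^ 'n \<Rightarrow> complex"
  assumes [measurable]: "f \<in> borel_measurable sphere_measure"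
  shows "zonal_mean m f \<in> borel_measurable sphere_measure"
  unfolding zonal_mean_def[abs_def]
  by (intro sphere_measure.borel_measurable_lebesgue_integral) measurable

lemma Lp_space_zonal_mean:
  fixes f :: "complex ^ 'n \<Rightarrow> complex"
  assumes p: "1 \<le> p" and f: "f \<in> Lp_space sphere_measure p"
  shows "zonal_mean m f \<in> Lp_space sphere_measure p"
    and "(\<integral>x. norm (zonal_mean m f x) powr p \<partial>sphere_measure) \<le> (\<integral>x. norm (f x) powr p \<partial>sphere_measure)"
proof -
  let ?M = "sphere_measure :: (complex ^ 'n) measure"
  have fi: "integrable ?M f"
    using Lp_space_integrable[OF sphere_measure.finite_measure_axioms p f] .
  have [measurable]: "f \<in> borel_measurable ?M" and fp: "integrable ?M (\<lambda>x. norm (f x) powr p)"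
    using f by (auto simp: Lp_space_def)
  have K: "0 \<le> zonal_kernel m x y" if "norm x = 1" "norm y = 1" for x y :: "complex ^ 'n"
    using that by (rule zonal_kernel_nonneg)
  have int: "integrable ?M (\<lambda>y. zonal_kernel m x y * norm (h y))" if "integrable ?M h" "norm x = 1" for x and h :: "complex ^ 'n \<Rightarrow> complex"
  proof -
    have "integrable ?M (\<lambda>y. zonal_kernel m x y * norm (h y)) \<longleftrightarrow> integrable ?M (\<lambda>y. norm (of_real (zonal_kernel m x y) * h y))"
      using that by (intro Bochner_Integration.integrable_cong) (auto simp: norm_mult K)
    then show ?thesis
      using integrable_norm[OF integrable_zonal_kernel_mult[OF that, of m]] by simp
  qed
  have intp: "integrable ?M (\<lambda>y. zonal_kernel m x y * norm (f y) powr p)" if "norm x = 1" for x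
    using int[OF _ that, of "\<lambda>y. of_real (norm (f y) powr p)"] fp by simp
  have bound: "norm (zonal_mean m f x) \<le> (\<integral>y. zonal_kernel m x y * norm (f y) \<partial>?M)" if "norm x = 1" for x
  proof -
    have "norm (zonal_mean m f x) \<le> (\<integral>y. norm (of_real (zonal_kernel m x y) * f y) \<partial>?M)"
      unfolding zonal_mean_def by (rule integral_norm_bound)
    also have "\<dots> = (\<integral>y. zonal_kernel m x y * norm (f y) \<partial>?M)"
      using that by (intro Bochner_Integration.integral_cong) (auto simp: norm_mult K)
    finally show ?thesis .
  qed
  \<comment> \<open>A crude bound by the maximum of the kernel: for fixed \<open>m\<close> the mean
    is a bounded function, hence in \<open>L\<^sup>p\<close>.\<close>
  have "norm (zonal_mean m f x) \<le> (2 ^ m / kernel_mass TYPE('n) m) * (\<integral>y. norm (f y) \<partial>?M)" if x: "norm x = 1" for x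
  proof -
    have "(\<integral>y. zonal_kernel m x y * norm (f y) \<partial>?M) \<le> (\<integral>y. (2 ^ m / kernel_mass TYPE('n) m) * norm (f y) \<partial>?M)"
      using fi zonal_kernel_le[OF x]
      by (intro integral_mono int x) (auto intro!: mult_right_mono simp del: times_divide_eq_left)
    then show ?thesis using bound[OF x] by simp
  qed
  then show 1: "zonal_mean m f \<in> Lp_space ?M p"
    using p by (intro sphere_measure.bounded_in_Lp_space[where B = "(2 ^ m / kernel_mass TYPE('n) m) * (\<integral>y. norm (f y) \<partial>?M)"] zonal_mean_measurable) auto
  have le: "norm (zonal_mean m f x) powr p \<le> (\<integral>y. zonal_kernel m x y * norm (f y) powr p \<partial>?M)" if x: "norm x = 1" for x
  proof -
    have "norm (zonal_mean m f x) powr p \<le> (\<integral>y. zonal_kernel m x y * norm (f y) \<partial>?M) powr p"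
      using bound[OF x] p by (intro powr_mono2) auto
    also have "\<dots> \<le> (\<integral>y. zonal_kernel m x y * norm (f y) powr p \<partial>?M)"
      using x p int[OF fi x] intp[OF x] integrable_zonal_kernel integral_zonal_kernel[OF x]
      by (intro weighted_integral_powr_le) (auto simp: K)
    finally show ?thesis .
  qed
  interpret pair_prob_space ?M ?M by standard
  \<comment> \<open>Nonnegative integrals allow the exchange of integrations without prior joint
    integrability. By symmetry the kernel also has integral 1 in \<open>x\<close>, so no constant is
    lost.\<close>
  have "ennreal (\<integral>x. norm (zonal_mean m f x) powr p \<partial>?M) = (\<integral>\<^sup>+x. ennreal (norm (zonal_mean m f x) powr p) \<partial>?M)"
    using 1 by (intro nn_integral_eq_integral[symmetric]) (auto simp: Lp_space_def)
  also have "\<dots> \<le> (\<integral>\<^sup>+x. (\<integral>\<^sup>+y. ennreal (zonal_kernel m x y * norm (f y) powr p) \<partial>?M) \<partial>?M)"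
  proof (rule nn_integral_mono)
    fix x :: "complex ^ 'n" assume "x \<in> space ?M"
    then have x: "norm x = 1" by simp
    have "(\<integral>\<^sup>+y. ennreal (zonal_kernel m x y * norm (f y) powr p) \<partial>?M) = ennreal (\<integral>y. zonal_kernel m x y * norm (f y) powr p \<partial>?M)"
      using intp[OF x] x by (intro nn_integral_eq_integral) (auto intro!: AE_I2 simp: K)
    then show "ennreal (norm (zonal_mean m f x) powr p) \<le> (\<integral>\<^sup>+y. ennreal (zonal_kernel m x y * norm (f y) powr p) \<partial>?M)"
      using le[OF x] by (simp add: ennreal_leI)
  qed
  also have "\<dots> = (\<integral>\<^sup>+y. (\<integral>\<^sup>+x. ennreal (zonal_kernel m x y * norm (f y) powr p) \<partial>?M) \<partial>?M)"
    by (rule Fubini'[symmetric]) measurable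
  also have "\<dots> = (\<integral>\<^sup>+y. ennreal (norm (f y) powr p) \<partial>?M)"
  proof (rule nn_integral_cong)
    fix y :: "complex ^ 'n" assume "y \<in> space ?M"
    then have y: "norm y = 1" by simp
    have "(\<integral>\<^sup>+x. ennreal (zonal_kernel m x y * norm (f y) powr p) \<partial>?M) = (\<integral>\<^sup>+x. ennreal (norm (f y) powr p * zonal_kernel m y x) \<partial>?M)"
      by (simp add: zonal_kernel_commute[of _ _ y] mult.commute)
    also have "\<dots> = ennreal (\<integral>x. norm (f y) powr p * zonal_kernel m y x \<partial>?M)"
      using y integrable_zonal_kernel by (intro nn_integral_eq_integral) (auto intro!: AE_I2 simp: K)
    also have "\<dots> = ennreal (norm (f y) powr p)"
      using integral_zonal_kernel[OF y, of m] by simp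
    finally show "(\<integral>\<^sup>+x. ennreal (zonal_kernel m x y * norm (f y) powr p) \<partial>?M) = ennreal (norm (f y) powr p)" .
  qed
  also have "\<dots> = ennreal (\<integral>x. norm (f x) powr p \<partial>?M)"
    using fp by (intro nn_integral_eq_integral) auto
  finally show "(\<integral>x. norm (zonal_mean m f x) powr p \<partial>?M) \<le> (\<integral>x. norm (f x) powr p \<partial>?M)"
    by (simp add: ennreal_le_iff Bochner_Integration.integral_nonneg)
qed

subsection \<open>Density of continuous functions\<close>

text \<open>Regularity encloses \<open>A\<close> between a compact \<open>K\<close> and an open
  \<open>U\<close> with little measure in between; a Urysohn function for this pair differs from the
  indicator on \<open>U - K\<close> only.\<close>

lemma indicator_approx_continuous:
  fixes M :: "'a :: euclidean_space measure"
  assumes "finite_measure M" "sets M = sets borel" "A \<in> sets borel" "0 < \<epsilon>"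
  obtains g :: "'a \<Rightarrow> real" where "continuous_on UNIV g" "\<And>x. g x \<in> {0..1}" "(\<integral>x. \<bar>indicator A x - g x\<bar> \<partial>M) < \<epsilon>"
proof -
  interpret finite_measure M by fact
  have space: "space M = UNIV" using sets_eq_imp_space_eq[OF assms(2)] by simp
  have fin: "emeasure M (space M) \<noteq> \<infinity>" by simp
  \<comment> \<open>Otherwise the supremum over compact subsets would stay below the measure of
    \<open>A\<close> by \<epsilon> / 2. The empty set, being compact, shows that this bound is
    nonnegative and so survives the passage to \<open>ennreal\<close>.\<close>
  have "\<exists>K. K \<subseteq> A \<and> compact K \<and> measure M A < measure M K + \<epsilon> / 2"
  proof (rule ccontr)
    assume neg: "\<not> ?thesis"
    then have "\<not> measure M A < measure M {} + \<epsilon> / 2"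
      using compact_empty by blast
    then have "\<epsilon> / 2 \<le> measure M A"
      by simp
    have "emeasure M K \<le> ennreal (measure M A - \<epsilon> / 2)" if "K \<subseteq> A" "compact K" for K
      using that neg by (force simp: emeasure_eq_measure intro!: ennreal_leI)
    then have "emeasure M A \<le> ennreal (measure M A - \<epsilon> / 2)"
      unfolding inner_regular[OF assms(2) fin assms(3)] by (intro SUP_least) auto
    then show False
      using \<open>0 < \<epsilon>\<close> \<open>\<epsilon> / 2 \<le> measure M A\<close> by (simp add: emeasure_eq_measure ennreal_le_iff2)
  qed
  then obtain K where K: "K \<subseteq> A" "compact K" "measure M A < measure M K + \<epsilon> / 2" by blast
  have "\<exists>U. A \<subseteq> U \<and> open U \<and> measure M U < measure M A + \<epsilon> / 2"
  proof (rule ccontr)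
    assume "\<not> ?thesis"
    then have "ennreal (measure M A + \<epsilon> / 2) \<le> emeasure M U" if "A \<subseteq> U" "open U" for U
      using that by (force simp: emeasure_eq_measure intro!: ennreal_leI)
    then have "ennreal (measure M A + \<epsilon> / 2) \<le> emeasure M A"
      unfolding outer_regular[OF assms(2) fin assms(3)] by (intro INF_greatest) auto
    then show False
      using \<open>0 < \<epsilon>\<close> measure_nonneg[of M A] by (simp add: emeasure_eq_measure ennreal_le_iff)
  qed
  then obtain U where U: "A \<subseteq> U" "open U" "measure M U < measure M A + \<epsilon> / 2" by blast
  obtain g :: "'a \<Rightarrow> real" where g: "continuous_on UNIV g" "\<And>x. g x \<in> closed_segment 1 0"
      "\<And>x. x \<in> K \<Longrightarrow> g x = 1" "\<And>x. x \<in> - U \<Longrightarrow> g x = 0"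
    using Urysohn[of K "- U" 1 "0 :: real"] K U compact_imp_closed[OF K(2)] by (metis (no_types, lifting) closed_Compl disjoint_eq_subset_Compl double_compl order_trans)
  have g01: "g x \<in> {0..1}" for x
    using g(2)[of x] by (simp add: closed_segment_eq_real_ivl)
  have [measurable]: "K \<in> sets M" "U \<in> sets M" "A \<in> sets M" "g \<in> borel_measurable M"
    using assms(2,3) K(2) U(2) borel_measurable_continuous_onI[OF g(1)]
    by (auto simp: borel_compact measurable_cong_sets[OF assms(2) refl])
  have "(\<integral>x. \<bar>indicator A x - g x\<bar> \<partial>M) \<le> (\<integral>x. indicator (U - K) x \<partial>M)"
  proof (rule integral_mono)
    show "integrable M (\<lambda>x. \<bar>indicator A x - g x\<bar>)"
      using g01 by (intro integrable_const_bound[where B = 1]) (auto simp: indicator_def intro!: AE_I2)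
    show "integrable M (indicator (U - K) :: 'a \<Rightarrow> real)"
      by (intro integrable_const_bound[where B = 1]) (auto simp: indicator_def)
    show "\<bar>indicator A x - g x\<bar> \<le> indicator (U - K) x" for x
      using g01[of x] g(3,4)[of x] K(1) U(1) by (auto simp: indicator_def)
  qed
  also have "\<dots> = measure M (U - K)"
    using space by simp
  also have "\<dots> = measure M U - measure M K"
    using K(1) U(1) by (intro finite_measure_Diff) auto
  also have "\<dots> < \<epsilon>" using K(3) U(3) by simp
  finally show ?thesis using that[OF g(1) g01] by blast
qed

lemma L1_approx_continuous:
  fixes f :: "complex ^ 'n \<Rightarrow> complex"
  assumes "integrable sphere_measure f" "0 < \<epsilon>"
  shows "\<exists>g. continuous_on UNIV g \<and> (\<integral>x. norm (f x - g x) \<partial>sphere_measure) < \<epsilon>"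
  using assms
proof (induction f arbitrary: \<epsilon> rule: integrable_induct)
  case (base A c)
  let ?M = "sphere_measure :: (complex ^ 'n) measure"
  \<comment> \<open>The sphere measure regarded as a Borel measure on the whole space, where
    regularity applies.\<close>
  let ?N = "distr ?M borel (\<lambda>x. x)"
  have A: "A \<in> sets borel"
    using base(1) by (auto simp: sets_sphere_measure sets_restrict_space_iff)
  have "finite_measure ?N"
    by (intro prob_space.finite_measure sphere_measure.prob_space_distr) simp
  \<comment> \<open>The summand 1 in \<open>norm c + 1\<close> covers the case
    \<open>c = 0\<close>.\<close>
  then obtain g :: "complex ^ 'n \<Rightarrow> real" where g: "continuous_on UNIV g" "\<And>x. g x \<in> {0..1}" "(\<integral>x. \<bar>indicator A x - g x\<bar> \<partial>?N) < \<epsilon> / (norm c + 1)"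
    using indicator_approx_continuous[OF _ _ A, of ?N "\<epsilon> / (norm c + 1)"] base(3) by (auto simp: add_nonneg_pos)
  have [measurable]: "g \<in> borel_measurable borel"
    using g(1) by (rule borel_measurable_continuous_onI)
  have "(\<integral>x. norm (indicator A x *\<^sub>R c - of_real (g x) * c) \<partial>?M) = (\<integral>x. \<bar>indicator A x - g x\<bar> * norm c \<partial>?M)"
    by (simp add: scaleR_conv_of_real norm_mult flip: left_diff_distrib of_real_diff)
  also have "\<dots> = (\<integral>x. \<bar>indicator A x - g x\<bar> \<partial>?N) * norm c"
    using A by (subst integral_distr) (auto, measurable)
  also have "\<dots> \<le> \<epsilon> / (norm c + 1) * norm c"
    using g(3) by (intro mult_right_mono) auto
  also have "\<dots> < \<epsilon>"
    using base(3) by (simp add: divide_less_eq add_nonneg_pos)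
  finally show ?case
    using g(1) by (intro exI[of _ "\<lambda>x. of_real (g x) * c"]) (auto intro!: continuous_intros)
next
  case (add f1 f2)
  obtain g1 where g1: "continuous_on UNIV g1" "(\<integral>x. norm (f1 x - g1 x) \<partial>sphere_measure) < \<epsilon> / 2"
    using add.IH(1)[of "\<epsilon> / 2"] add.prems by auto
  obtain g2 where g2: "continuous_on UNIV g2" "(\<integral>x. norm (f2 x - g2 x) \<partial>sphere_measure) < \<epsilon> / 2"
    using add.IH(2)[of "\<epsilon> / 2"] add.prems by auto
  have i: "integrable sphere_measure g1" "integrable sphere_measure g2"
    using g1 g2 by (auto intro!: integrable_sphere_measure_continuous_on intro: continuous_on_subset)
  have "(\<integral>x. norm (f1 x + f2 x - (g1 x + g2 x)) \<partial>sphere_measure) \<le> (\<integral>x. norm (f1 x - g1 x) + norm (f2 x - g2 x) \<partial>sphere_measure)"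
    using i add.hyps by (intro integral_mono) (auto intro: norm_diff_triangle_ineq)
  also have "\<dots> < \<epsilon>"
    using i add.hyps g1 g2 by simp
  finally show ?case
    using g1 g2 by (intro exI[of _ "\<lambda>x. g1 x + g2 x"]) (auto intro!: continuous_intros)
next
  case (lim f s)
  have "(\<lambda>i. \<integral>x. norm (f x - s i x) \<partial>sphere_measure) \<longlonglongrightarrow> (\<integral>x. norm (0 :: complex) \<partial>(sphere_measure :: (complex ^ 'n) measure))"
  proof (rule integral_dominated_convergence)
    show "integrable sphere_measure (\<lambda>x. 3 * norm (f x))" using lim.hyps by auto
    show "AE x in sphere_measure. (\<lambda>i. norm (f x - s i x)) \<longlonglongrightarrow> norm (0 :: complex)"
      using lim.hyps by (intro AE_I2) (auto intro!: tendsto_eq_intros)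
    show "AE x in sphere_measure. norm (norm (f x - s i x)) \<le> 3 * norm (f x)" for i
    proof (rule AE_I2)
      fix x :: "complex ^ 'n" assume "x \<in> space sphere_measure"
      then have "norm (s i x) \<le> 2 * norm (f x)" using lim.hyps by auto
      then show "norm (norm (f x - s i x)) \<le> 3 * norm (f x)"
        using norm_triangle_ineq4[of "f x" "s i x"] by simp
    qed
  qed (use lim.hyps in auto)
  then have "\<forall>\<^sub>F i in sequentially. (\<integral>x. norm (f x - s i x) \<partial>sphere_measure) < \<epsilon> / 2"
    using lim.prems by (auto intro!: order_tendstoD(2))
  then obtain i where i: "(\<integral>x. norm (f x - s i x) \<partial>sphere_measure) < \<epsilon> / 2"
    by (auto simp: eventually_sequentially)
  obtain g where g: "continuous_on UNIV g" "(\<integral>x. norm (s i x - g x) \<partial>sphere_measure) < \<epsilon> / 2"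
    using lim.IH[of "\<epsilon> / 2" i] lim.prems by auto
  have ig: "integrable sphere_measure g"
    using g by (auto intro!: integrable_sphere_measure_continuous_on intro: continuous_on_subset)
  have "(\<integral>x. norm (f x - g x) \<partial>sphere_measure) \<le> (\<integral>x. norm (f x - s i x) + norm (s i x - g x) \<partial>sphere_measure)"
  proof (rule integral_mono)
    show "norm (f x - g x) \<le> norm (f x - s i x) + norm (s i x - g x)" for x
      using norm_triangle_ineq[of "f x - s i x" "s i x - g x"] by simp
  qed (use ig lim.hyps in auto)
  also have "\<dots> < \<epsilon>"
    using ig lim.hyps i g by simp
  finally show ?case using g by blast
qed

text \<open>Truncation reduces the claim to bounded functions, for which the p-th power of the error
  is at most a constant times the error itself, so that density in \<open>L\<^sup>1\<close>
  suffices.\<close>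

lemma Lp_approx_continuous:
  fixes f :: "complex ^ 'n \<Rightarrow> complex"
  assumes p: "1 \<le> p" and f: "f \<in> Lp_space sphere_measure p" and "0 < \<epsilon>"
  shows "\<exists>g. continuous_on UNIV g \<and> (\<integral>x. norm (f x - g x) powr p \<partial>sphere_measure) < \<epsilon>"
proof -
  let ?M = "sphere_measure :: (complex ^ 'n) measure"
  \<comment> \<open>The nearest-point retraction onto the disc of radius \<open>N\<close>. It is
    1-Lipschitz, so truncating \<open>f\<close> and its approximant alike does not increase their
    distance.\<close>
  define P where "P N = closest_point (cball (0 :: complex) N)" for N :: real
  have [measurable]: "f \<in> borel_measurable ?M" and fp: "integrable ?M (\<lambda>x. norm (f x) powr p)"
    using f by (auto simp: Lp_space_def)
  have fi: "integrable ?M f"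
    using Lp_space_integrable[OF sphere_measure.finite_measure_axioms p f] .
  have P_cont: "continuous_on UNIV (P N)" if "N \<ge> 0" for N
    unfolding P_def using that by (intro continuous_on_closest_point) auto
  then have P_meas: "P N \<in> borel_measurable borel" if "N \<ge> 0" for N
    using that by (intro borel_measurable_continuous_onI)
  have P_norm: "norm (P N z) \<le> N" if "N \<ge> 0" for N z
    using closest_point_in_set[of "cball 0 N" z] that by (simp add: P_def)
  have P_dist: "norm (P N z - P N w) \<le> norm (z - w)" if "N \<ge> 0" for N z w
    using closest_point_lipschitz[of "cball 0 N" z w] that by (simp add: P_def dist_norm)
  have P_le: "norm (z - P N z) \<le> norm z" if "N \<ge> 0" for N z
    using closest_point_le[of "cball 0 N" 0 z] that by (simp add: P_def dist_norm)
  define \<eta> where "\<eta> = \<epsilon> / (2 * 2 powr p)"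
  have "\<eta> > 0" using \<open>0 < \<epsilon>\<close> by (simp add: \<eta>_def)
  have "(\<lambda>i. \<integral>x. norm (f x - P (real i) (f x)) powr p \<partial>?M) \<longlonglongrightarrow> (\<integral>x. 0 \<partial>?M)"
  proof (rule integral_dominated_convergence[where w = "\<lambda>x. norm (f x) powr p"])
    show "(\<lambda>x. norm (f x - P (real i) (f x)) powr p) \<in> borel_measurable ?M" for i
      using measurable_compose[OF \<open>f \<in> borel_measurable ?M\<close> P_meas[of "real i"]] by measurable
    show "AE x in ?M. (\<lambda>i. norm (f x - P (real i) (f x)) powr p) \<longlonglongrightarrow> 0"
    proof (intro AE_I2 tendsto_eventually)
      fix x
      show "\<forall>\<^sub>F i in sequentially. norm (f x - P (real i) (f x)) powr p = 0"
        using eventually_ge_at_top[of "nat \<lceil>norm (f x)\<rceil>"]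
      proof eventually_elim
        case (elim i)
        then have "f x \<in> cball 0 (real i)" by (simp add: nat_ceiling_le_eq)
        then show ?case by (simp add: P_def closest_point_self)
      qed
    qed
    show "AE x in ?M. norm (norm (f x - P (real i) (f x)) powr p) \<le> norm (f x) powr p" for i
      using p P_le by (intro AE_I2) (auto intro!: powr_mono2)
  qed (use fp in auto)
  then have "\<forall>\<^sub>F i in sequentially. (\<integral>x. norm (f x - P (real i) (f x)) powr p \<partial>?M) < \<eta>"
    using \<open>\<eta> > 0\<close> by (auto intro!: order_tendstoD(2))
  then obtain i where i: "i \<ge> 1" "(\<integral>x. norm (f x - P (real i) (f x)) powr p \<partial>?M) < \<eta>"
    unfolding eventually_sequentially by (metis le_add1 le_add2)
  define N where "N = real i"
  have N: "N \<ge> 1" "N \<ge> 0" "(\<integral>x. norm (f x - P N (f x)) powr p \<partial>?M) < \<eta>"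
    using i by (auto simp: N_def)
  \<comment> \<open>Two truncated values differ by some \<open>t\<close> of at most
    \<open>2 * N\<close>, whence \<open>t powr p \<le> c * t\<close>.\<close>
  define c where "c = (2 * N) powr (p - 1)"
  have "c > 0" using N by (simp add: c_def)
  obtain g where g: "continuous_on UNIV g" "(\<integral>x. norm (f x - g x) \<partial>?M) < \<eta> / c"
    using L1_approx_continuous[OF fi, of "\<eta> / c"] \<open>\<eta> > 0\<close> \<open>c > 0\<close> by auto
  have gi: "integrable ?M g"
    using g(1) by (auto intro!: integrable_sphere_measure_continuous_on intro: continuous_on_subset)
  have [measurable]: "g \<in> borel_measurable ?M" using gi by auto
  have Pg: "continuous_on UNIV (\<lambda>x. P N (g x))"
    by (rule continuous_on_compose2[OF P_cont[OF N(2)] g(1)]) simp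
  have [measurable]: "(\<lambda>x. P N (f x)) \<in> borel_measurable ?M" "(\<lambda>x. P N (g x)) \<in> borel_measurable ?M"
    using measurable_compose[OF \<open>f \<in> borel_measurable ?M\<close> P_meas[OF N(2)]]
      measurable_compose[OF \<open>g \<in> borel_measurable ?M\<close> P_meas[OF N(2)]] by auto
  have le: "norm (P N (f x) - P N (g x)) powr p \<le> c * norm (f x - g x)" for x
  proof -
    define t where "t = norm (P N (f x) - P N (g x))"
    have t: "0 \<le> t" "t \<le> norm (f x - g x)" "t \<le> 2 * N"
      using P_dist[OF N(2)] P_norm[OF N(2), of "f x"] P_norm[OF N(2), of "g x"]
        norm_triangle_ineq4[of "P N (f x)" "P N (g x)"] by (auto simp: t_def)
    have "t powr p = t powr (p - 1) * t"
    proof (cases "t = 0")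
      case False
      then have "t powr (p - 1) * t powr 1 = t powr p" by (simp only: powr_add[symmetric]) simp
      then show ?thesis using t by simp
    qed simp
    also have "\<dots> \<le> c * norm (f x - g x)"
      unfolding c_def using t p by (intro mult_mono powr_mono2) auto
    finally show ?thesis by (simp add: t_def)
  qed
  have int1: "integrable ?M (\<lambda>x. norm (f x - P N (f x)) powr p)"
    by (rule Bochner_Integration.integrable_bound[OF fp]) (use p P_le N in \<open>auto intro!: powr_mono2 AE_I2\<close>)
  have int2: "integrable ?M (\<lambda>x. c * norm (f x - g x))"
    using fi gi by auto
  have int3: "integrable ?M (\<lambda>x. norm (P N (f x) - P N (g x)) powr p)"
    by (rule Bochner_Integration.integrable_bound[OF int2]) (use le \<open>c > 0\<close> in \<open>auto intro!: AE_I2\<close>)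
  have int4: "integrable ?M (\<lambda>x. norm (f x - P N (g x)) powr p)"
    using Lp_space_diff[OF _ f continuous_on_in_Lp_space[OF continuous_on_subset[OF Pg subset_UNIV]]] p
    by (simp add: Lp_space_def)
  have "(\<integral>x. norm (f x - P N (g x)) powr p \<partial>?M) \<le> (\<integral>x. 2 powr p * (norm (f x - P N (f x)) powr p + c * norm (f x - g x)) \<partial>?M)"
  proof (rule integral_mono)
    fix x
    have "norm (f x - P N (g x)) powr p \<le> 2 powr p * (norm (f x - P N (f x)) powr p + norm (P N (f x) - P N (g x)) powr p)"
      using norm_add_powr_le[of p "f x - P N (f x)" "P N (f x) - P N (g x)"] p by simp
    also have "\<dots> \<le> 2 powr p * (norm (f x - P N (f x)) powr p + c * norm (f x - g x))"
      using le[of x] by (intro mult_left_mono add_left_mono) auto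
    finally show "norm (f x - P N (g x)) powr p \<le> 2 powr p * (norm (f x - P N (f x)) powr p + c * norm (f x - g x))" .
  qed (use int1 int2 int4 in auto)
  also have "\<dots> = 2 powr p * ((\<integral>x. norm (f x - P N (f x)) powr p \<partial>?M) + c * (\<integral>x. norm (f x - g x) \<partial>?M))"
    using int1 fi gi by simp
  also have "\<dots> < 2 powr p * (\<eta> + c * (\<eta> / c))"
    using N g(2) \<open>c > 0\<close> by (intro mult_strict_left_mono add_strict_mono) auto
  also have "\<dots> = \<epsilon>"
    using \<open>c > 0\<close> by (simp add: \<eta>_def)
  finally show ?thesis using Pg by blast
qed

text \<open>A continuous \<open>g\<close> close to \<open>f\<close> splits the error into the mean
  of \<open>f - g\<close>, which contractivity controls, the difference \<open>f - g\<close> itself,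
  and the uniform error for \<open>g\<close>.\<close>

lemma zonal_mean_Lp_approx:
  fixes f :: "complex ^ 'n \<Rightarrow> complex"
  assumes p: "1 \<le> p" and f: "f \<in> Lp_space sphere_measure p" and "0 < \<epsilon>"
  shows "\<exists>m. (\<integral>x. norm (f x - zonal_mean m f x) powr p \<partial>sphere_measure) < \<epsilon>"
proof -
  let ?M = "sphere_measure :: (complex ^ 'n) measure"
  define c where "c = (2 :: real) powr p"
  have c: "c > 0" by (simp add: c_def)
  \<comment> \<open>Splitting three terms takes two applications of \<open>norm_add_powr_le\<close>,
    which cost \<open>c\<close> for the first term and \<open>c * c\<close> for each of the other
    two.\<close>
  define \<eta> where "\<eta> = \<epsilon> / (c + 2 * (c * c))"
  have "c + 2 * (c * c) > 0" using c by (simp add: add_pos_pos)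
  then have \<eta>: "\<eta> > 0" "(c + 2 * (c * c)) * \<eta> = \<epsilon>" using \<open>0 < \<epsilon>\<close> by (simp_all add: \<eta>_def)
  obtain g where g: "continuous_on UNIV g" "(\<integral>x. norm (f x - g x) powr p \<partial>?M) < \<eta>"
    using Lp_approx_continuous[OF p f \<eta>(1)] by blast
  have gS: "continuous_on (sphere 0 1) g"
    using g(1) continuous_on_subset by blast
  obtain m where m: "\<And>x. norm x = 1 \<Longrightarrow> norm (zonal_mean m g x - g x) \<le> \<eta> powr (1 / p)"
    using zonal_mean_uniform_approx[OF gS, of "\<eta> powr (1 / p)"] \<eta>(1) by auto
  have gL: "g \<in> Lp_space ?M p"
    using continuous_on_in_Lp_space[OF gS] p by simp
  have fgL: "(\<lambda>x. f x - g x) \<in> Lp_space ?M p"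
    using Lp_space_diff[OF _ f gL] p by simp
  let ?T = "zonal_mean m"
  note fi = Lp_space_integrable[OF sphere_measure.finite_measure_axioms p f]
  note gi = Lp_space_integrable[OF sphere_measure.finite_measure_axioms p gL]
  have lin: "?T (\<lambda>x. f x - g x) x = ?T f x - ?T g x" if "norm x = 1" for x
    unfolding zonal_mean_def right_diff_distrib
    by (intro Bochner_Integration.integral_diff integrable_zonal_kernel_mult fi gi that)
  have intT: "integrable ?M (\<lambda>x. norm (?T (\<lambda>x. f x - g x) x) powr p)"
    using Lp_space_zonal_mean(1)[OF p fgL] by (simp add: Lp_space_def)
  have intfg: "integrable ?M (\<lambda>x. norm (f x - g x) powr p)"
    using fgL by (simp add: Lp_space_def)
  have intfT: "integrable ?M (\<lambda>x. norm (f x - ?T f x) powr p)"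
    using Lp_space_diff[OF _ f Lp_space_zonal_mean(1)[OF p f]] p by (simp add: Lp_space_def)
  have "(\<integral>x. norm (f x - ?T f x) powr p \<partial>?M) \<le>
      (\<integral>x. c * (norm (?T (\<lambda>x. f x - g x) x) powr p + c * (norm (f x - g x) powr p + \<eta>)) \<partial>?M)"
  proof (rule integral_mono)
    fix x :: "complex ^ 'n" assume "x \<in> space ?M"
    then have x: "norm x = 1" by simp
    have "norm (?T g x - g x) powr p \<le> (\<eta> powr (1 / p)) powr p"
      using m[OF x] p by (intro powr_mono2) auto
    also have "\<dots> = \<eta>" using p \<eta>(1) by (simp add: powr_powr)
    finally have 1: "norm (g x - ?T g x) powr p \<le> \<eta>" by (simp add: norm_minus_commute)
    have "norm (f x - ?T f x) powr p = norm (- ?T (\<lambda>x. f x - g x) x + ((f x - g x) + (g x - ?T g x))) powr p"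
      by (simp add: lin[OF x])
    also have "\<dots> \<le> c * (norm (- ?T (\<lambda>x. f x - g x) x) powr p + norm ((f x - g x) + (g x - ?T g x)) powr p)"
      unfolding c_def using p by (intro norm_add_powr_le) simp
    also have "\<dots> \<le> c * (norm (?T (\<lambda>x. f x - g x) x) powr p + c * (norm (f x - g x) powr p + norm (g x - ?T g x) powr p))"
      using norm_add_powr_le[of p "f x - g x" "g x - ?T g x"] p c
      by (intro mult_left_mono add_mono) (auto simp: c_def)
    also have "\<dots> \<le> c * (norm (?T (\<lambda>x. f x - g x) x) powr p + c * (norm (f x - g x) powr p + \<eta>))"
      using 1 c by (intro mult_left_mono add_left_mono) auto
    finally show "norm (f x - ?T f x) powr p \<le> \<dots>" .
  qed (use intT intfg intfT in auto)
  also have "\<dots> = c * ((\<integral>x. norm (?T (\<lambda>x. f x - g x) x) powr p \<partial>?M) + c * ((\<integral>x. norm (f x - g x) powr p \<partial>?M) + \<eta>))"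
    using intT intfg sphere_measure.prob_space[where 'n = 'n] by simp
  also have "\<dots> < c * (\<eta> + c * (\<eta> + \<eta>))"
  proof (rule mult_strict_left_mono[OF add_strict_mono c])
    show "(\<integral>x. norm (?T (\<lambda>x. f x - g x) x) powr p \<partial>?M) < \<eta>"
      using Lp_space_zonal_mean(2)[OF p fgL, of m] g(2) by simp
    show "c * ((\<integral>x. norm (f x - g x) powr p \<partial>?M) + \<eta>) < c * (\<eta> + \<eta>)"
      using g(2) c by simp
  qed
  also have "\<dots> = \<epsilon>"
    using \<eta>(2) by (simp add: algebra_simps)
  finally show ?thesis by blast
qed

subsection \<open>Zonal means of functions satisfying the moment conditions\<close>

definition multi_indices :: "nat \<Rightarrow> ('n :: finite \<Rightarrow> nat) set" where
  "multi_indices k = {\<alpha>. sum \<alpha> UNIV = k}"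

lemma finite_multi_indices: "finite (multi_indices k :: ('n :: finite \<Rightarrow> nat) set)"
proof (rule finite_subset)
  show "multi_indices k \<subseteq> (UNIV :: 'n set) \<rightarrow>\<^sub>E {..k}"
  proof
    fix \<alpha> :: "'n \<Rightarrow> nat" assume "\<alpha> \<in> multi_indices k"
    then have "\<alpha> i \<le> k" for i
      using member_le_sum[of i UNIV \<alpha>] by (auto simp: multi_indices_def)
    then show "\<alpha> \<in> UNIV \<rightarrow>\<^sub>E {..k}" by auto
  qed
qed (simp add: finite_PiE)

lemma multi_indices_0: "multi_indices 0 = {\<lambda>_. 0}"
  by (auto simp: multi_indices_def)

definition multi_fact :: "('n :: finite \<Rightarrow> nat) \<Rightarrow> complex" where
  "multi_fact \<alpha> = (\<Prod>i\<in>UNIV. fact (\<alpha> i))"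

lemma multi_fact_nonzero [simp]: "multi_fact \<alpha> \<noteq> 0"
  by (simp add: multi_fact_def)

lemma multi_fact_Suc: "multi_fact (\<alpha>(i := Suc (\<alpha> i))) = of_nat (Suc (\<alpha> i)) * multi_fact \<alpha>"
  unfolding multi_fact_def by (subst (1 2) prod.remove[of UNIV i]) (auto simp: algebra_simps)

lemma sum_fun_upd_Suc: "sum (\<alpha>(i := Suc (\<alpha> i))) (UNIV :: 'n :: finite set) = Suc (sum \<alpha> UNIV)"
  by (subst (1 2) sum.remove[of UNIV i]) auto

text \<open>\<open>h k\<close> is the k-th power of the sum divided by k!. Multiplication by
  \<open>x $ i\<close> shifts the index by one in coordinate \<open>i\<close> and produces the
  weight \<open>\<beta> i\<close>; these weights add up to the degree \<open>k + 1\<close>, which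
  gives the recursion for \<open>h\<close>.\<close>

lemma multinomial_theorem:
  fixes x :: "complex ^ 'n"
  shows "(\<Sum>i\<in>UNIV. x $ i) ^ k = (\<Sum>\<alpha>\<in>multi_indices k. fact k / multi_fact \<alpha> * vec_power x \<alpha>)"
proof -
  define h where "h k = (\<Sum>\<alpha>\<in>multi_indices k. vec_power x \<alpha> / multi_fact \<alpha>)" for k
  have step: "(\<Sum>i\<in>UNIV. x $ i) * h k = of_nat (Suc k) * h (Suc k)" for k
  proof -
    have 1: "x $ i * h k = (\<Sum>\<beta>\<in>multi_indices (Suc k). of_nat (\<beta> i) * (vec_power x \<beta> / multi_fact \<beta>))" for i
    proof -
      have "x $ i * h k = (\<Sum>\<alpha>\<in>multi_indices k. x $ i * vec_power x \<alpha> / multi_fact \<alpha>)"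
        by (simp add: h_def sum_distrib_left)
      also have "\<dots> = (\<Sum>\<beta>\<in>{\<beta> \<in> multi_indices (Suc k). \<beta> i \<noteq> 0}. of_nat (\<beta> i) * (vec_power x \<beta> / multi_fact \<beta>))"
      proof (rule sum.reindex_bij_witness[of _ "\<lambda>\<beta>. \<beta>(i := \<beta> i - 1)" "\<lambda>\<alpha>. \<alpha>(i := Suc (\<alpha> i))"])
        fix \<beta> assume \<beta>: "\<beta> \<in> {\<beta> \<in> multi_indices (Suc k). \<beta> i \<noteq> 0}"
        then show "(\<beta>(i := \<beta> i - 1))(i := Suc ((\<beta>(i := \<beta> i - 1)) i)) = \<beta>"
          by (auto simp: fun_eq_iff)
        then have "sum \<beta> UNIV = Suc (sum (\<beta>(i := \<beta> i - 1)) UNIV)"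
          by (metis sum_fun_upd_Suc)
        then show "\<beta>(i := \<beta> i - 1) \<in> multi_indices k"
          using \<beta> by (simp add: multi_indices_def)
      next
        fix \<alpha> :: "'n \<Rightarrow> nat" assume \<alpha>: "\<alpha> \<in> multi_indices k"
        show "(\<alpha>(i := Suc (\<alpha> i)))(i := (\<alpha>(i := Suc (\<alpha> i))) i - 1) = \<alpha>" by simp
        show "\<alpha>(i := Suc (\<alpha> i)) \<in> {\<beta> \<in> multi_indices (Suc k). \<beta> i \<noteq> 0}"
          using \<alpha> by (auto simp: multi_indices_def sum_fun_upd_Suc simp del: fun_upd_apply) simp
        show "of_nat ((\<alpha>(i := Suc (\<alpha> i))) i) * (vec_power x (\<alpha>(i := Suc (\<alpha> i))) / multi_fact (\<alpha>(i := Suc (\<alpha> i)))) =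
          x $ i * vec_power x \<alpha> / multi_fact \<alpha>"
          by (simp add: multi_fact_Suc vec_power_Suc del: of_nat_Suc)
      qed
      also have "\<dots> = (\<Sum>\<beta>\<in>multi_indices (Suc k). of_nat (\<beta> i) * (vec_power x \<beta> / multi_fact \<beta>))"
        by (rule sum.mono_neutral_left) (auto simp: finite_multi_indices)
      finally show ?thesis .
    qed
    have "(\<Sum>i\<in>UNIV. x $ i) * h k = (\<Sum>\<beta>\<in>multi_indices (Suc k). \<Sum>i\<in>UNIV. of_nat (\<beta> i) * (vec_power x \<beta> / multi_fact \<beta>))"
      unfolding sum_distrib_right 1 by (rule sum.swap)
    also have "\<dots> = (\<Sum>\<beta>\<in>multi_indices (Suc k). of_nat (Suc k) * (vec_power x \<beta> / multi_fact \<beta>))"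
      unfolding sum_distrib_right[symmetric] of_nat_sum[symmetric]
      by (intro sum.cong) (auto simp: multi_indices_def)
    finally show ?thesis
      by (simp add: h_def sum_distrib_left)
  qed
  have "(\<Sum>i\<in>UNIV. x $ i) ^ k = fact k * h k"
  proof (induction k)
    case 0
    show ?case by (simp add: h_def multi_indices_0 vec_power_def multi_fact_def)
  next
    case (Suc k)
    then show ?case
      using step[of k] by (simp add: algebra_simps)
  qed
  then show ?thesis by (simp add: h_def sum_distrib_left)
qed

section \<open>A(S) as a vector space containing the holomorphic monomials\<close>

lemma sphere_algebraI:
  assumes "continuous_on UNIV G" "\<And>j z. (\<lambda>w. G (\<chi> i. if i = j then w else z $ i)) holomorphic_on UNIV"
    and "\<And>\<zeta>. norm \<zeta> = 1 \<Longrightarrow> g \<zeta> = G \<zeta>"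
  shows "g \<in> sphere_algebra"
  unfolding sphere_algebra_def sep_holomorphic_on_ball_def
  using assms continuous_on_subset[OF assms(1)] holomorphic_on_subset[OF assms(2)]
  by (auto intro!: exI[of _ G])

lemma sphere_algebra_cong:
  assumes "g \<in> sphere_algebra" "\<And>\<zeta>. norm \<zeta> = 1 \<Longrightarrow> h \<zeta> = g \<zeta>"
  shows "h \<in> sphere_algebra"
  using assms unfolding sphere_algebra_def by auto

lemma sphere_algebra_const_mult:
  assumes "g \<in> sphere_algebra"
  shows "(\<lambda>\<zeta>. c * g \<zeta>) \<in> sphere_algebra"
proof -
  obtain G where G: "continuous_on (cball 0 1) G" "sep_holomorphic_on_ball G" "\<forall>\<zeta>\<in>sphere 0 1. g \<zeta> = G \<zeta>"
    using assms unfolding sphere_algebra_def by auto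
  have "continuous_on (cball 0 1) (\<lambda>z. c * G z)"
    using G by (intro continuous_intros)
  moreover have "sep_holomorphic_on_ball (\<lambda>z. c * G z)"
    using G(2) unfolding sep_holomorphic_on_ball_def
    by (auto intro!: continuous_intros holomorphic_on_mult holomorphic_on_const)
  ultimately show ?thesis
    using G(3) unfolding sphere_algebra_def by auto
qed

lemma sphere_algebra_add:
  assumes "g \<in> sphere_algebra" "h \<in> sphere_algebra"
  shows "(\<lambda>\<zeta>. g \<zeta> + h \<zeta>) \<in> sphere_algebra"
proof -
  obtain G where G: "continuous_on (cball 0 1) G" "sep_holomorphic_on_ball G" "\<forall>\<zeta>\<in>sphere 0 1. g \<zeta> = G \<zeta>"
    using assms unfolding sphere_algebra_def by auto
  obtain H where H: "continuous_on (cball 0 1) H" "sep_holomorphic_on_ball H" "\<forall>\<zeta>\<in>sphere 0 1. h \<zeta> = H \<zeta>"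
    using assms unfolding sphere_algebra_def by auto
  have "continuous_on (cball 0 1) (\<lambda>z. G z + H z)"
    using G H by (intro continuous_intros)
  moreover have "sep_holomorphic_on_ball (\<lambda>z. G z + H z)"
    using G(2) H(2) unfolding sep_holomorphic_on_ball_def
    by (auto intro!: continuous_intros holomorphic_on_add)
  ultimately show ?thesis
    using G(3) H(3) unfolding sphere_algebra_def by auto
qed

lemma sphere_algebra_sum:
  assumes "finite I" "\<And>i. i \<in> I \<Longrightarrow> g i \<in> sphere_algebra"
  shows "(\<lambda>\<zeta>. \<Sum>i\<in>I. g i \<zeta>) \<in> sphere_algebra"
  using assms
proof (induction I rule: finite_induct)
  case empty
  show ?case by (rule sphere_algebraI[of "\<lambda>_. 0"]) auto
next
  case (insert i I)
  then show ?case by (simp add: sphere_algebra_add)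
qed

lemma sphere_algebra_vec_power: "(\<lambda>\<zeta>. vec_power \<zeta> \<alpha>) \<in> sphere_algebra"
proof (rule sphere_algebraI[of "\<lambda>z. vec_power z \<alpha>"])
  fix j and z :: "complex ^ 'a"
  have "(\<lambda>w. (if i = j then w else z $ i) ^ \<alpha> i) holomorphic_on UNIV" for i
    by (cases "i = j") (auto intro!: holomorphic_intros)
  then show "(\<lambda>w. vec_power (\<chi> i. if i = j then w else z $ i) \<alpha>) holomorphic_on UNIV"
    by (auto simp: vec_power_def intro!: holomorphic_on_prod)
qed (auto intro!: continuous_intros)

section \<open>The Hermitian product and the moments of its powers\<close>

definition cinner :: "complex ^ 'n \<Rightarrow> complex ^ 'n \<Rightarrow> complex" where
  "cinner x y = (\<Sum>i\<in>UNIV. x $ i * cnj (y $ i))"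

lemma inner_eq_cinner: "complex_of_real (x \<bullet> y) = (cinner x y + cnj (cinner x y)) / 2"
proof -
  have "x \<bullet> y = Re (cinner x y)"
    by (simp add: inner_vec_def cinner_def inner_complex_def)
  then show ?thesis by (simp add: complex_add_cnj)
qed

lemma cinner_self: "norm x = 1 \<Longrightarrow> cinner x x = 1"
  unfolding cinner_def complex_norm_square[symmetric] of_real_sum[symmetric] norm_vec_complex_sq[symmetric] by simp

lemma vec_power_mult_cnj: "vec_power (\<chi> i. x $ i * cnj (y $ i)) \<alpha> = vec_power x \<alpha> * cnj (vec_power y \<alpha>)"
  by (simp add: vec_power_def power_mult_distrib prod.distrib)

lemma cinner_power: "cinner x y ^ k = (\<Sum>\<alpha>\<in>multi_indices k. fact k / multi_fact \<alpha> * (vec_power x \<alpha> * cnj (vec_power y \<alpha>)))"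
  using multinomial_theorem[of "\<chi> i. x $ i * cnj (y $ i)" k] by (simp only: vec_power_mult_cnj vec_lambda_beta cinner_def)

lemma cnj_multi_fact [simp]: "cnj (multi_fact \<alpha>) = multi_fact \<alpha>"
  by (simp add: multi_fact_def)

lemma cnj_cinner_power: "cnj (cinner x y) ^ k = (\<Sum>\<alpha>\<in>multi_indices k. fact k / multi_fact \<alpha> * (cnj (vec_power x \<alpha>) * vec_power y \<alpha>))"
proof -
  have "cnj (cinner x y) ^ k = cnj (cinner x y ^ k)" by simp
  also have "\<dots> = (\<Sum>\<alpha>\<in>multi_indices k. fact k / multi_fact \<alpha> * (cnj (vec_power x \<alpha>) * vec_power y \<alpha>))"
    unfolding cinner_power by (simp add: cnj_sum)
  finally show ?thesis .
qed

lemma multi_coeff_multi_fact: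
  fixes \<beta> :: "'n :: finite \<Rightarrow> nat"
  assumes "\<beta> \<in> multi_indices k"
  shows "complex_of_real (multi_coeff \<beta>) = fact (CARD('n) - 1) * multi_fact \<beta> / fact (CARD('n) - 1 + k)"
  using assms by (simp add: multi_coeff_def multi_fact_def multi_indices_def)

text \<open>The factor \<open>\<beta>!\<close> of \<open>c\<^sub>\<beta>\<close> cancels the denominator of the multinomial expansion of \<open>cinner x y ^ j\<close>,
  so that the remaining sum over \<open>\<alpha>\<close> is \<open>cinner x x ^ k = 1\<close>.\<close>

lemma cinner_moment_in_sphere_algebra:
  fixes f :: "complex ^ 'n \<Rightarrow> complex"
  assumes f: "integrable sphere_measure f"
    and 0: "\<And>\<alpha> \<beta> i. \<beta> i < \<alpha> i \<Longrightarrow> (\<integral>y. vec_power y \<alpha> * cnj (vec_power y \<beta>) * f y \<partial>sphere_measure) = 0"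
    and d: "\<And>\<alpha> \<gamma>. (\<integral>y. vec_power y \<alpha> * cnj (vec_power y (\<lambda>i. \<alpha> i + \<gamma> i)) * f y \<partial>sphere_measure) =
       complex_of_real (multi_coeff (\<lambda>i. \<alpha> i + \<gamma> i)) * d \<gamma>"
  shows "(\<lambda>x. \<integral>y. cinner x y ^ j * cnj (cinner x y) ^ k * f y \<partial>sphere_measure) \<in> sphere_algebra"
proof -
  define M where "M \<alpha> \<beta> = (\<integral>y. vec_power y \<alpha> * cnj (vec_power y \<beta>) * f y \<partial>sphere_measure)" for \<alpha> \<beta> :: "'n \<Rightarrow> nat"
  have int: "integrable sphere_measure (\<lambda>y. vec_power y \<alpha> * cnj (vec_power y \<beta>) * f y)" for \<alpha> \<beta>
    by (intro integrable_sphere_measure_continuous_mult f continuous_intros)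
  define I where "I x = (\<integral>y. cinner x y ^ j * cnj (cinner x y) ^ k * f y \<partial>sphere_measure)" for x
  define w where "w x \<alpha> \<beta> = (fact j / multi_fact \<beta> * vec_power x \<beta>) * (fact k / multi_fact \<alpha> * cnj (vec_power x \<alpha>))" for x :: "complex ^ 'n" and \<alpha> \<beta>
  have I: "I x = (\<Sum>\<beta>\<in>multi_indices j. \<Sum>\<alpha>\<in>multi_indices k. w x \<alpha> \<beta> * M \<alpha> \<beta>)" for x
  proof -
    have "cinner x y ^ j * cnj (cinner x y) ^ k * f y =
        (\<Sum>\<beta>\<in>multi_indices j. \<Sum>\<alpha>\<in>multi_indices k. w x \<alpha> \<beta> * (vec_power y \<alpha> * cnj (vec_power y \<beta>) * f y))" for y
      unfolding cinner_power cnj_cinner_power sum_product w_def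
      unfolding sum_distrib_right by (intro sum.cong refl) (simp add: mult_ac)
    then have "I x = (\<integral>y. (\<Sum>\<beta>\<in>multi_indices j. \<Sum>\<alpha>\<in>multi_indices k. w x \<alpha> \<beta> * (vec_power y \<alpha> * cnj (vec_power y \<beta>) * f y)) \<partial>sphere_measure)"
      by (simp add: I_def)
    then show ?thesis
      unfolding M_def
      by (simp only: Bochner_Integration.integral_sum Bochner_Integration.integrable_sum
          integrable_mult_right int Bochner_Integration.integral_mult_right_zero)
  qed
  show ?thesis
  \<comment> \<open>The integrals involve \<beta> of degree \<open>j\<close> and \<alpha> of degree
    \<open>k\<close>. If \<open>j < k\<close>, some coordinate of \<alpha> exceeds that of \<beta>,
    and condition (a) removes every term.\<close>
  proof (cases "k \<le> j")
    case False
    have "M \<alpha> \<beta> = 0" if ab: "\<alpha> \<in> multi_indices k" "\<beta> \<in> multi_indices j" for \<alpha> \<beta> :: "'n \<Rightarrow> nat"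
    proof -
      have "\<exists>i. \<beta> i < \<alpha> i"
      proof (rule ccontr)
        assume "\<not> ?thesis"
        then have "sum \<alpha> UNIV \<le> sum \<beta> UNIV" by (intro sum_mono) (auto simp: not_less)
        then show False using ab False by (simp add: multi_indices_def)
      qed
      then show ?thesis using 0 unfolding M_def by blast
    qed
    then have "I x = 0" for x by (simp add: I)
    then show ?thesis
      unfolding I_def using sphere_algebra_sum[of "{}"] by simp
  next
    case True
    \<comment> \<open>What is left of \<open>multi_coeff \<beta>\<close> times the multinomial
      coefficient of \<beta> after \<beta>! cancels; it depends on the degree \<open>j\<close>
      only.\<close>
    define \<kappa> where "\<kappa> = fact j * fact (CARD('n) - 1) / (fact (CARD('n) - 1 + j) :: complex)"
    have add: "(\<lambda>i. \<alpha> i + \<gamma> i) \<in> multi_indices j" if "\<alpha> \<in> multi_indices k" "\<gamma> \<in> multi_indices (j - k)" for \<alpha> \<gamma> :: "'n \<Rightarrow> nat"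
      using that True by (simp add: multi_indices_def sum.distrib)
    \<comment> \<open>Condition (a) leaves only the \<beta> that dominate \<alpha>, and these are
      exactly the sums \<alpha> + \<gamma> with \<gamma> of degree \<open>j - k\<close>.\<close>
    have inner: "(\<Sum>\<beta>\<in>multi_indices j. w x \<alpha> \<beta> * M \<alpha> \<beta>) = (\<Sum>\<gamma>\<in>multi_indices (j - k). w x \<alpha> (\<lambda>i. \<alpha> i + \<gamma> i) * M \<alpha> (\<lambda>i. \<alpha> i + \<gamma> i))"
      if \<alpha>: "\<alpha> \<in> multi_indices k" for x \<alpha>
    proof -
      have "(\<Sum>\<gamma>\<in>multi_indices (j - k). w x \<alpha> (\<lambda>i. \<alpha> i + \<gamma> i) * M \<alpha> (\<lambda>i. \<alpha> i + \<gamma> i)) =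
          (\<Sum>\<beta>\<in>{\<beta> \<in> multi_indices j. \<forall>i. \<alpha> i \<le> \<beta> i}. w x \<alpha> \<beta> * M \<alpha> \<beta>)"
      proof (rule sum.reindex_bij_witness[of _ "\<lambda>\<beta> i. \<beta> i - \<alpha> i" "\<lambda>\<gamma> i. \<alpha> i + \<gamma> i"])
        fix \<beta> assume \<beta>: "\<beta> \<in> {\<beta> \<in> multi_indices j. \<forall>i. \<alpha> i \<le> \<beta> i}"
        then show "(\<lambda>i. \<alpha> i + (\<beta> i - \<alpha> i)) = \<beta>" by auto
        have "(\<Sum>i\<in>UNIV. \<beta> i - \<alpha> i) = sum \<beta> UNIV - sum \<alpha> UNIV"
          using \<beta> by (intro sum_subtractf_nat) auto
        then show "(\<lambda>i. \<beta> i - \<alpha> i) \<in> multi_indices (j - k)"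
          using \<alpha> \<beta> by (simp add: multi_indices_def)
      qed (use add[OF \<alpha>] in auto)
      also have "\<dots> = (\<Sum>\<beta>\<in>multi_indices j. w x \<alpha> \<beta> * M \<alpha> \<beta>)"
      proof (rule sum.mono_neutral_left)
        show "\<forall>\<beta>\<in>multi_indices j - {\<beta> \<in> multi_indices j. \<forall>i. \<alpha> i \<le> \<beta> i}. w x \<alpha> \<beta> * M \<alpha> \<beta> = 0"
        proof
          fix \<beta> assume "\<beta> \<in> multi_indices j - {\<beta> \<in> multi_indices j. \<forall>i. \<alpha> i \<le> \<beta> i}"
          then obtain i where "\<beta> i < \<alpha> i" by (auto simp: not_le)
          then show "w x \<alpha> \<beta> * M \<alpha> \<beta> = 0" using 0 by (simp add: M_def)
        qed
      qed (auto simp: finite_multi_indices)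
      finally show ?thesis by simp
    qed
    have summand: "w x \<alpha> (\<lambda>i. \<alpha> i + \<gamma> i) * M \<alpha> (\<lambda>i. \<alpha> i + \<gamma> i) =
        (\<kappa> * d \<gamma> * vec_power x \<gamma>) * (fact k / multi_fact \<alpha> * (vec_power x \<alpha> * cnj (vec_power x \<alpha>)))"
      if "\<alpha> \<in> multi_indices k" "\<gamma> \<in> multi_indices (j - k)" for x \<alpha> \<gamma>
      unfolding M_def d multi_coeff_multi_fact[OF add[OF that]]
      unfolding w_def \<kappa>_def vec_power_add by (simp add: mult_ac)
    have "I x = (\<Sum>\<gamma>\<in>multi_indices (j - k). (\<kappa> * d \<gamma>) * vec_power x \<gamma>)" if x: "norm x = 1" for x
    proof -
      have "I x = (\<Sum>\<alpha>\<in>multi_indices k. \<Sum>\<beta>\<in>multi_indices j. w x \<alpha> \<beta> * M \<alpha> \<beta>)"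
        unfolding I by (rule sum.swap)
      also have "\<dots> = (\<Sum>\<alpha>\<in>multi_indices k. \<Sum>\<gamma>\<in>multi_indices (j - k).
          (\<kappa> * d \<gamma> * vec_power x \<gamma>) * (fact k / multi_fact \<alpha> * (vec_power x \<alpha> * cnj (vec_power x \<alpha>))))"
        by (simp add: inner summand cong: sum.cong)
      also have "\<dots> = (\<Sum>\<gamma>\<in>multi_indices (j - k). \<kappa> * d \<gamma> * vec_power x \<gamma>) * cinner x x ^ k"
        unfolding cinner_power sum_product by (rule sum.swap)
      finally show ?thesis by (simp add: cinner_self[OF x])
    qed
    moreover have "(\<lambda>x. \<Sum>\<gamma>\<in>multi_indices (j - k). (\<kappa> * d \<gamma>) * vec_power x \<gamma>) \<in> (sphere_algebra :: (complex ^ 'n \<Rightarrow> complex) set)"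
      by (intro sphere_algebra_sum finite_multi_indices sphere_algebra_const_mult sphere_algebra_vec_power)
    ultimately show ?thesis
      unfolding I_def[symmetric] by (rule sphere_algebra_cong[rotated])
  qed
qed

text \<open>With u = \<open>cinner x y\<close> the kernel is a multiple of (1 + (u + cnj u) / 2)^m.
  Two binomial expansions reduce the mean to finitely many integrals of u^j (cnj u)^k against
  \<open>f\<close>.\<close>

lemma zonal_mean_in_sphere_algebra:
  fixes f :: "complex ^ 'n \<Rightarrow> complex"
  assumes f: "integrable sphere_measure f"
    and 0: "\<And>\<alpha> \<beta> i. \<beta> i < \<alpha> i \<Longrightarrow> (\<integral>y. vec_power y \<alpha> * cnj (vec_power y \<beta>) * f y \<partial>sphere_measure) = 0"
    and d: "\<And>\<alpha> \<gamma>. (\<integral>y. vec_power y \<alpha> * cnj (vec_power y (\<lambda>i. \<alpha> i + \<gamma> i)) * f y \<partial>sphere_measure) =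
       complex_of_real (multi_coeff (\<lambda>i. \<alpha> i + \<gamma> i)) * d \<gamma>"
  shows "zonal_mean m f \<in> sphere_algebra"
proof -
  define I where "I j k x = (\<integral>y. cinner x y ^ j * cnj (cinner x y) ^ k * f y \<partial>sphere_measure)" for j k x
  define c where "c l j = of_nat (m choose l) * (1 / 2) ^ l * of_nat (l choose j) / complex_of_real (kernel_mass TYPE('n) m)" for l j
  have int: "integrable sphere_measure (\<lambda>y. cinner x y ^ j * cnj (cinner x y) ^ k * f y)" for x j k
    unfolding cinner_def by (intro integrable_sphere_measure_continuous_mult f continuous_intros)
  have "zonal_mean m f x = (\<Sum>l\<le>m. \<Sum>j\<le>l. c l j * I j (l - j) x)" for x
  proof -
    have "complex_of_real ((1 + x \<bullet> y) ^ m) = (\<Sum>l\<le>m. of_nat (m choose l) * (1 / 2) ^ l *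
        (\<Sum>j\<le>l. of_nat (l choose j) * cinner x y ^ j * cnj (cinner x y) ^ (l - j)))" for y
    proof -
      have "complex_of_real ((1 + x \<bullet> y) ^ m) = (1 / 2 * (cinner x y + cnj (cinner x y)) + 1) ^ m"
        by (simp add: inner_eq_cinner add.commute)
      also have "\<dots> = (\<Sum>l\<le>m. of_nat (m choose l) * (1 / 2 * (cinner x y + cnj (cinner x y))) ^ l)"
        by (subst binomial_ring) simp
      finally show ?thesis
        by (simp only: power_mult_distrib binomial_ring mult.assoc)
    qed
    then have "complex_of_real (zonal_kernel m x y) * f y =
        (\<Sum>l\<le>m. \<Sum>j\<le>l. c l j * (cinner x y ^ j * cnj (cinner x y) ^ (l - j) * f y))" for y
      unfolding zonal_kernel_def of_real_divide c_def
      by (simp add: sum_distrib_left sum_distrib_right sum_divide_distrib mult_ac)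
    then have "zonal_mean m f x = (\<integral>y. (\<Sum>l\<le>m. \<Sum>j\<le>l. c l j * (cinner x y ^ j * cnj (cinner x y) ^ (l - j) * f y)) \<partial>sphere_measure)"
      by (simp add: zonal_mean_def)
    then show ?thesis
      unfolding I_def
      by (simp only: Bochner_Integration.integral_sum Bochner_Integration.integrable_sum
          integrable_mult_right int Bochner_Integration.integral_mult_right_zero)
  qed
  then have "zonal_mean m f = (\<lambda>x. \<Sum>l\<le>m. \<Sum>j\<le>l. c l j * I j (l - j) x)"
    by (rule ext)
  moreover have "I j k \<in> sphere_algebra" for j k
    unfolding I_def[abs_def] using f 0 d by (rule cinner_moment_in_sphere_algebra)
  ultimately show ?thesis
    by (simp add: sphere_algebra_sum sphere_algebra_const_mult)
qed


theorem theorem2p5: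
  fixes p :: real and f :: "complex ^ 'n \<Rightarrow> complex"
  assumes "1 \<le> p" and "f \<in> Lp_space sphere_measure p"
  shows "f \<in> Hardy_space p \<longleftrightarrow>
    (\<forall>\<alpha> \<beta> :: 'n \<Rightarrow> nat.
       ((\<exists>j. \<alpha> j > \<beta> j) \<longrightarrow>
          (\<integral>\<zeta>. vec_power \<zeta> \<alpha> * vec_power (vec_cnj \<zeta>) \<beta> * f \<zeta> \<partial>sphere_measure) = 0) \<and>
       ((\<forall>j. \<alpha> j \<le> \<beta> j) \<longrightarrow>
          complex_of_real (inverse (multi_coeff \<beta>)) *
            (\<integral>\<zeta>. vec_power \<zeta> \<alpha> * vec_power (vec_cnj \<zeta>) \<beta> * f \<zeta> \<partial>sphere_measure) =
          complex_of_real (inverse (multi_coeff (\<lambda>j. \<beta> j - \<alpha> j))) *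
            (\<integral>\<zeta>. vec_power (vec_cnj \<zeta>) (\<lambda>j. \<beta> j - \<alpha> j) * f \<zeta> \<partial>sphere_measure)))"
proof -
  let ?M = "sphere_measure :: (complex ^ 'n) measure"
  have fi: "integrable ?M f"
    using Lp_space_integrable[OF sphere_measure.finite_measure_axioms assms] .
  have vec_power_0: "vec_power z (\<lambda>_. 0) = 1" for z :: "complex ^ 'n"
    by (simp add: vec_power_def)
  \<comment> \<open>Condition (b) with \<beta> written as \<alpha> + \<gamma>, which avoids
    truncated subtraction.\<close>
  have conj_moment: "complex_of_real (inverse (multi_coeff \<beta>)) * (\<integral>z. vec_power z \<alpha> * cnj (vec_power z \<beta>) * f z \<partial>?M) =
      complex_of_real (inverse (multi_coeff \<gamma>)) * (\<integral>z. cnj (vec_power z \<gamma>) * f z \<partial>?M)"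
    if f: "f \<in> Hardy_space p" and \<beta>: "\<beta> = (\<lambda>i. \<alpha> i + \<gamma> i)" for \<alpha> \<beta> \<gamma> :: "'n \<Rightarrow> nat"
  proof -
    define a b where "a = complex_of_real (inverse (multi_coeff \<beta>))" and "b = complex_of_real (inverse (multi_coeff \<gamma>))"
    \<comment> \<open>Both sides of (b) are combined into one functional given by a continuous
      function, so that the annihilator argument applies to it.\<close>
    have split: "(\<integral>z. (a * (vec_power z \<alpha> * cnj (vec_power z \<beta>)) - b * cnj (vec_power z \<gamma>)) * h z \<partial>?M) =
        a * (\<integral>z. vec_power z \<alpha> * cnj (vec_power z \<beta>) * h z \<partial>?M) - b * (\<integral>z. cnj (vec_power z \<gamma>) * h z \<partial>?M)"
      if "integrable ?M h" for h
    proof -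
      have "integrable ?M (\<lambda>z. vec_power z \<alpha> * cnj (vec_power z \<beta>) * h z)" "integrable ?M (\<lambda>z. cnj (vec_power z \<gamma>) * h z)"
        by (intro integrable_sphere_measure_continuous_mult that continuous_intros)+
      then show ?thesis
        by (simp add: left_diff_distrib mult.assoc)
    qed
    have "(\<integral>z. (a * (vec_power z \<alpha> * cnj (vec_power z \<beta>)) - b * cnj (vec_power z \<gamma>)) * f z \<partial>?M) = 0"
    proof (rule Hardy_space_annihilator[OF assms(1) f])
      fix g :: "complex ^ 'n \<Rightarrow> complex" assume g: "g \<in> sphere_algebra"
      \<comment> \<open>The same \<open>C\<close> is used at \<alpha> and at the zero index; after
        division by \<open>multi_coeff\<close> both sides of (b) equal it.\<close>
      obtain C where C: "\<And>\<alpha>. (\<integral>z. vec_power z \<alpha> * cnj (vec_power z (\<lambda>i. \<alpha> i + \<gamma> i)) * g z \<partial>?M) =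
          C * of_real (multi_coeff (\<lambda>i. \<alpha> i + \<gamma> i))"
        using sphere_algebra_moments[OF g] by metis
      have gi: "integrable ?M g"
        using g by (intro integrable_sphere_measure_continuous_on sphere_algebra_continuous_on)
      have "multi_coeff \<beta> \<noteq> 0" "multi_coeff \<gamma> \<noteq> 0"
        by (simp_all add: multi_coeff_pos less_imp_neq[symmetric])
      then show "(\<integral>z. (a * (vec_power z \<alpha> * cnj (vec_power z \<beta>)) - b * cnj (vec_power z \<gamma>)) * g z \<partial>?M) = 0"
        unfolding split[OF gi] using C[of \<alpha>] C[of "\<lambda>_. 0"] by (simp add: \<beta>[symmetric] vec_power_0 a_def b_def)
    qed (intro continuous_intros)
    then show ?thesis
      using split[OF fi] by (simp add: a_def b_def)
  qed
  show ?thesis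
    unfolding vec_power_vec_cnj
  proof (intro iffI allI conjI impI)
    fix \<alpha> \<beta> :: "'n \<Rightarrow> nat"
    assume f: "f \<in> Hardy_space p"
    show "(\<integral>z. vec_power z \<alpha> * cnj (vec_power z \<beta>) * f z \<partial>?M) = 0" if "\<exists>j. \<alpha> j > \<beta> j"
      using that sphere_algebra_moments_0
      by (intro Hardy_space_annihilator[OF assms(1) f]) (auto intro!: continuous_intros)
    show "complex_of_real (inverse (multi_coeff \<beta>)) * (\<integral>z. vec_power z \<alpha> * cnj (vec_power z \<beta>) * f z \<partial>?M) =
      complex_of_real (inverse (multi_coeff (\<lambda>j. \<beta> j - \<alpha> j))) * (\<integral>z. cnj (vec_power z (\<lambda>j. \<beta> j - \<alpha> j)) * f z \<partial>?M)"
      if "\<forall>j. \<alpha> j \<le> \<beta> j"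
      using that by (intro conj_moment[OF f]) auto
  next
    assume *: "\<forall>\<alpha> \<beta>. ((\<exists>j. \<beta> j < \<alpha> j) \<longrightarrow> (\<integral>z. vec_power z \<alpha> * cnj (vec_power z \<beta>) * f z \<partial>?M) = 0) \<and>
      ((\<forall>j. \<alpha> j \<le> \<beta> j) \<longrightarrow>
        complex_of_real (inverse (multi_coeff \<beta>)) * (\<integral>z. vec_power z \<alpha> * cnj (vec_power z \<beta>) * f z \<partial>?M) =
        complex_of_real (inverse (multi_coeff (\<lambda>j. \<beta> j - \<alpha> j))) * (\<integral>z. cnj (vec_power z (\<lambda>j. \<beta> j - \<alpha> j)) * f z \<partial>?M))"
    \<comment> \<open>The normalized moments, which are the prospective Taylor coefficients of
      \<open>f\<close>.\<close>
    define d where "d \<gamma> = complex_of_real (inverse (multi_coeff \<gamma>)) * (\<integral>z. cnj (vec_power z \<gamma>) * f z \<partial>?M)" for \<gamma>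
    have "(\<integral>z. vec_power z \<alpha> * cnj (vec_power z (\<lambda>i. \<alpha> i + \<gamma> i)) * f z \<partial>?M) =
        complex_of_real (multi_coeff (\<lambda>i. \<alpha> i + \<gamma> i)) * d \<gamma>" for \<alpha> \<gamma>
    proof -
      have "complex_of_real (inverse (multi_coeff (\<lambda>i. \<alpha> i + \<gamma> i))) *
          (\<integral>z. vec_power z \<alpha> * cnj (vec_power z (\<lambda>i. \<alpha> i + \<gamma> i)) * f z \<partial>?M) = d \<gamma>"
        using *[rule_format, THEN conjunct2, of \<alpha> "\<lambda>i. \<alpha> i + \<gamma> i"] by (simp add: d_def)
      moreover have "multi_coeff (\<lambda>i. \<alpha> i + \<gamma> i) \<noteq> 0"
        by (simp add: multi_coeff_pos less_imp_neq[symmetric])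
      ultimately show ?thesis by (auto simp: field_simps)
    qed
    moreover have "(\<integral>z. vec_power z \<alpha> * cnj (vec_power z \<beta>) * f z \<partial>?M) = 0" if "\<beta> i < \<alpha> i" for \<alpha> \<beta> i
      using * that by blast
    ultimately have poly: "zonal_mean m f \<in> sphere_algebra" for m
      by (intro zonal_mean_in_sphere_algebra[OF fi])
    have "\<exists>g\<in>sphere_algebra. Lp_norm ?M p (\<lambda>z. f z - g z) < \<epsilon>" if "\<epsilon> > 0" for \<epsilon>
    proof -
      \<comment> \<open>\<open>Lp_norm\<close> takes a p-th root, so the integral has to be below
        the p-th power of \<epsilon>.\<close>
      obtain m where m: "(\<integral>x. norm (f x - zonal_mean m f x) powr p \<partial>?M) < \<epsilon> powr p"
        using zonal_mean_Lp_approx[OF assms, of "\<epsilon> powr p"] \<open>\<epsilon> > 0\<close> by auto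
      have "Lp_norm ?M p (\<lambda>z. f z - zonal_mean m f z) < (\<epsilon> powr p) powr (1 / p)"
        unfolding Lp_norm_def using m assms(1)
        by (intro powr_less_mono2) (auto intro!: Bochner_Integration.integral_nonneg)
      also have "\<dots> = \<epsilon>"
        using assms(1) \<open>\<epsilon> > 0\<close> by (simp add: powr_powr)
      finally show ?thesis using poly by blast
    qed
    then show "f \<in> Hardy_space p"
      using assms(2) by (simp add: Hardy_space_def)
  qed
qed

end
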